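(* Let $H\subseteq G$ be an inclusion of discrete groups. Let $\Gamma\subseteq G$ be the semigroup of one sided quasi-normalizers of $H$ in $G$, let $H_1=\Gamma\cap\Gamma^{-1}$, and let $H_2$ be the subgroup of $G$ generated by $\Gamma$. Then (i) $q\mathcal{N}_{L(G)}(L(H))''=L(H_1)$; (ii) $W^*(q\mathcal{N}_{L(G)}^{(1)}(L(H)))=L(H_2)$.
   Context: $L(G)$ is the (left) group von Neumann algebra of the discrete group $G$, and for a subgroup $K\subseteq G$, $L(K)$ is regarded as the von Neumann subalgebra of $L(G)$ generated by the group unitaries of $K$. $G$ is not assumed to be I.C.C. An element $g\in G$ is a one sided quasi-normalizer of $H$ if there is a finite set $\{g_1,\dots,g_n\}\subseteq G$ with $Hg\subseteq\bigcup_{i=1}^n g_iH$. These elements form a semigroup $\Gamma=q\mathcal{N}_G^{(1)}(H)$. For a von Neumann subalgebra $B\subseteq M$: an element $x\in M$ is a one sided quasi-normalizer of $B$ if there is a finite set $\{x_1,\dots,x_n\}\subseteq M$ with $Bx\subseteq\sum_{i=1}^n x_iB$; the set of these is $q\mathcal{N}^{(1)}_M(B)$, and $W^*(q\mathcal{N}^{(1)}_M(B))$ is the von Neumann algebra it generates. An element $x\in M$ is a quasi-normalizer of $B$ if there is a finite set $\{x_1,\dots,x_n\}\subseteq M$ with $Bx\subseteq\sum_{i=1}^n x_iB$ and $xB\subseteq\sum_{i=1}^n Bx_i$; the set of these is $q\mathcal{N}_M(B)$, and $q\mathcal{N}_M(B)''$ is the von Neumann algebra it generates. *)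

theory Defs
  imports "HOL-Analysis.Infinite_Sum" "HOL-Algebra.Generated_Groups"
begin

text \<open>
  The Hilbert space of square-summable functions on a set \<open>X\<close> is modelled by functions on
  the ambient type that vanish off \<open>X\<close>.  An operator is a function on all of
  \<open>'a \<Rightarrow> complex\<close>; its irrelevant values outside the Hilbert space are fixed to be 0,
  so that equality, composition and finite sums of operators are those of functions.
\<close>

type_synonym 'a vec = "'a \<Rightarrow> complex"
type_synonym 'a oper = "'a vec \<Rightarrow> 'a vec"

definition ell2 :: "'a set \<Rightarrow> 'a vec set" where
  "ell2 X = {\<xi>. (\<forall>x. x \<notin> X \<longrightarrow> \<xi> x = 0) \<and> (\<lambda>x. (cmod (\<xi> x))\<^sup>2) summable_on X}"

definition ell2_inner :: "'a set \<Rightarrow> 'a vec \<Rightarrow> 'a vec \<Rightarrow> complex" where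
  "ell2_inner X \<xi> \<eta> = (\<Sum>\<^sub>\<infinity>x\<in>X. \<xi> x * cnj (\<eta> x))"

definition ell2_norm :: "'a set \<Rightarrow> 'a vec \<Rightarrow> real" where
  "ell2_norm X \<xi> = sqrt (\<Sum>\<^sub>\<infinity>x\<in>X. (cmod (\<xi> x))\<^sup>2)"

definition bounded_ops :: "'a set \<Rightarrow> 'a oper set" where
  "bounded_ops X = {T.
     (\<forall>\<xi>. \<xi> \<notin> ell2 X \<longrightarrow> T \<xi> = (\<lambda>_. 0)) \<and>
     (\<forall>\<xi>\<in>ell2 X. T \<xi> \<in> ell2 X) \<and>
     (\<forall>\<xi>\<in>ell2 X. \<forall>\<eta>\<in>ell2 X. T (\<lambda>x. \<xi> x + \<eta> x) = (\<lambda>x. T \<xi> x + T \<eta> x)) \<and>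
     (\<forall>c. \<forall>\<xi>\<in>ell2 X. T (\<lambda>x. c * \<xi> x) = (\<lambda>x. c * T \<xi> x)) \<and>
     (\<exists>C. \<forall>\<xi>\<in>ell2 X. ell2_norm X (T \<xi>) \<le> C * ell2_norm X \<xi>)}"

definition is_adjoint :: "'a set \<Rightarrow> 'a oper \<Rightarrow> 'a oper \<Rightarrow> bool" where
  "is_adjoint X T S \<longleftrightarrow>
     (\<forall>\<xi>\<in>ell2 X. \<forall>\<eta>\<in>ell2 X. ell2_inner X (T \<xi>) \<eta> = ell2_inner X \<xi> (S \<eta>))"

definition commutant :: "'a set \<Rightarrow> 'a oper set \<Rightarrow> 'a oper set" where
  "commutant X S = {T \<in> bounded_ops X. \<forall>A\<in>S. T \<circ> A = A \<circ> T}"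

text \<open>
  A von Neumann algebra is a self-adjoint set of bounded operators that equals its double
  commutant (such a set is automatically a unital subalgebra).
\<close>

definition von_Neumann_algebra :: "'a set \<Rightarrow> 'a oper set \<Rightarrow> bool" where
  "von_Neumann_algebra X M \<longleftrightarrow>
     M \<subseteq> bounded_ops X \<and> (\<forall>T\<in>M. \<exists>S\<in>M. is_adjoint X T S) \<and>
     commutant X (commutant X M) = M"

definition vN_generated :: "'a set \<Rightarrow> 'a oper set \<Rightarrow> 'a oper set" where
  "vN_generated X S = \<Inter>{M. von_Neumann_algebra X M \<and> S \<subseteq> M}"

definition left_regular :: "('a, 'b) monoid_scheme \<Rightarrow> 'a \<Rightarrow> 'a oper" where
  "left_regular G g = (\<lambda>\<xi>. if \<xi> \<in> ell2 (carrier G)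
     then (\<lambda>x. if x \<in> carrier G then \<xi> (inv\<^bsub>G\<^esub> g \<otimes>\<^bsub>G\<^esub> x) else 0)
     else (\<lambda>_. 0))"

text \<open>
  \<open>group_vNa G K\<close> is \<open>L(K)\<close> acting on \<open>\<ell>\<^sup>2(G)\<close>, that is, as a subalgebra of
  \<open>L(G) = group_vNa G (carrier G)\<close>.
\<close>

definition group_vNa :: "('a, 'b) monoid_scheme \<Rightarrow> 'a set \<Rightarrow> 'a oper set" where
  "group_vNa G K = vN_generated (carrier G) (left_regular G ` K)"

definition group_qn1 :: "('a, 'b) monoid_scheme \<Rightarrow> 'a set \<Rightarrow> 'a set" where
  "group_qn1 G H = {g \<in> carrier G. \<exists>F. finite F \<and> F \<subseteq> carrier G \<and>
     H #>\<^bsub>G\<^esub> g \<subseteq> (\<Union>x\<in>F. x <#\<^bsub>G\<^esub> H)}"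

text \<open>The sets \<open>\<Sum>\<^sub>i x\<^sub>i B\<close> and \<open>\<Sum>\<^sub>i B x\<^sub>i\<close>, where the \<open>x\<^sub>i\<close> run through the finite set \<open>F\<close>.\<close>

definition sum_right_mult :: "'a oper set \<Rightarrow> 'a oper set \<Rightarrow> 'a oper set" where
  "sum_right_mult F B = {(\<lambda>\<xi> v. \<Sum>y\<in>F. (y \<circ> c y) \<xi> v) | c. \<forall>y\<in>F. c y \<in> B}"

definition sum_left_mult :: "'a oper set \<Rightarrow> 'a oper set \<Rightarrow> 'a oper set" where
  "sum_left_mult B F = {(\<lambda>\<xi> v. \<Sum>y\<in>F. (c y \<circ> y) \<xi> v) | c. \<forall>y\<in>F. c y \<in> B}"

definition vN_qn1 :: "'a oper set \<Rightarrow> 'a oper set \<Rightarrow> 'a oper set" where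
  "vN_qn1 M B = {x \<in> M. \<exists>F. finite F \<and> F \<subseteq> M \<and> (\<lambda>b. b \<circ> x) ` B \<subseteq> sum_right_mult F B}"

definition vN_qn :: "'a oper set \<Rightarrow> 'a oper set \<Rightarrow> 'a oper set" where
  "vN_qn M B = {x \<in> M. \<exists>F. finite F \<and> F \<subseteq> M \<and>
     (\<lambda>b. b \<circ> x) ` B \<subseteq> sum_right_mult F B \<and> (\<lambda>b. x \<circ> b) ` B \<subseteq> sum_left_mult B F}"

end

theory Submission
  imports Defs "HOL-Analysis.L2_Norm"
begin

text \<open>
  An element of \<open>L(G)\<close> is left convolution by the function \<open>f = x \<delta>\<^sub>1\<close> in \<open>\<ell>\<^sup>2(G)\<close>, and for a
  subgroup \<open>K\<close> the elements of \<open>L(K)\<close> are exactly those whose function is supported in \<open>K\<close>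
  (\<open>group_vNa_matrix\<close>, \<open>group_vNa_support\<close>, \<open>group_vNa_if_support\<close>).  So both equalities are
  questions about supports.

  The heart is \<open>vN_qn1_support\<close>: the function of a one sided quasi-normalizer \<open>x\<close> of \<open>L(H)\<close> is
  supported in \<open>\<Gamma>\<close>.  The value of an element of \<open>\<Sum>\<^sub>i x\<^sub>i L(H)\<close> at a point is bounded, up to a
  constant, by the 2-norms of the \<open>x\<^sub>i\<close> on the left coset of \<open>H\<close> through that point, and these are
  small for all but finitely many cosets.  If \<open>f(g) \<noteq> 0\<close> for some \<open>g\<close> outside \<open>\<Gamma>\<close>, then the points \<open>hg\<close> with
  \<open>h\<close> in \<open>H\<close> run through infinitely many left cosets, and a suitable series
  \<open>b = \<Sum>\<^sub>k r\<^sup>k h\<^sub>k\<close> in \<open>L(H)\<close> makes \<open>b x\<close> too large at infinitely many of them.  For a two sided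
  quasi-normalizer, the adjoint is a one sided one too, so the support lies in
  \<open>\<Gamma> \<inter> \<Gamma>\<^sup>-\<^sup>1 = H\<^sub>1\<close>.  As \<open>H\<^sub>1\<close> and \<open>H\<^sub>2\<close> are subgroups, the quasi-normalizers lie in \<open>L(H\<^sub>1)\<close>
  and \<open>L(H\<^sub>2)\<close>, respectively.

  Conversely, if \<open>Hg\<close> is covered by finitely many disjoint cosets \<open>tH\<close>, then each \<open>b \<lambda>(g)\<close> with
  \<open>b\<close> in \<open>L(H)\<close> is cut along these cosets into a sum of elements of \<open>\<lambda>(t) L(H)\<close>, the
  coefficients being conditional expectations onto \<open>L(H)\<close> (\<open>cond_exp\<close>).  Hence \<open>\<lambda>(g)\<close> is a one
  sided quasi-normalizer for \<open>g\<close> in \<open>\<Gamma>\<close>, and a quasi-normalizer for \<open>g\<close> in \<open>H\<^sub>1\<close>; these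
  unitaries generate \<open>L(H\<^sub>2)\<close> and \<open>L(H\<^sub>1)\<close>.
\<close>

section \<open>Square-summable functions\<close>

lemma ell2_norm_nonneg [simp]: "0 \<le> ell2_norm X v"
  by (simp add: ell2_norm_def infsum_nonneg)

lemma ell2_outside: "v \<in> ell2 X \<Longrightarrow> x \<notin> X \<Longrightarrow> v x = 0"
  by (simp add: ell2_def)

text \<open>
  A norm bound is a uniform bound over the finite subsets of \<open>X\<close>; together with the next lemma
  this turns estimates in \<open>\<ell>\<^sup>2(X)\<close> into inequalities between finite sums.
\<close>

lemma ell2_if_L2_set_le:
  assumes out: "\<And>x. x \<notin> X \<Longrightarrow> v x = 0" and B: "0 \<le> B"
    and bd: "\<And>F. finite F \<Longrightarrow> F \<subseteq> X \<Longrightarrow> L2_set (\<lambda>x. cmod (v x)) F \<le> B"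
  shows "v \<in> ell2 X" "ell2_norm X v \<le> B"
proof -
  have le: "(\<Sum>x\<in>F. (cmod (v x))\<^sup>2) \<le> B\<^sup>2" if "finite F" "F \<subseteq> X" for F
  proof -
    have "(L2_set (\<lambda>x. cmod (v x)) F)\<^sup>2 \<le> B\<^sup>2"
      using bd[OF that] by (intro power_mono) auto
    thus ?thesis by (simp add: L2_set_def sum_nonneg)
  qed
  have summ: "(\<lambda>x. (cmod (v x))\<^sup>2) summable_on X"
  proof (rule nonneg_bdd_above_summable_on)
    show "bdd_above (sum (\<lambda>x. (cmod (v x))\<^sup>2) ` {F. F \<subseteq> X \<and> finite F})"
      by (rule bdd_aboveI2[of _ _ "B\<^sup>2"]) (use le in auto)
  qed auto
  with out show "v \<in> ell2 X" by (simp add: ell2_def)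
  have "(\<Sum>\<^sub>\<infinity>x\<in>X. (cmod (v x))\<^sup>2) \<le> B\<^sup>2"
    by (rule infsum_le_finite_sums[OF summ]) (use le in auto)
  hence "ell2_norm X v \<le> sqrt (B\<^sup>2)"
    unfolding ell2_norm_def by (rule real_sqrt_le_mono)
  with B show "ell2_norm X v \<le> B" by simp
qed

lemma L2_set_le_ell2_norm:
  assumes "v \<in> ell2 X" "finite F" "F \<subseteq> X"
  shows "L2_set (\<lambda>x. cmod (v x)) F \<le> ell2_norm X v"
  unfolding L2_set_def ell2_norm_def
  using assms by (intro real_sqrt_le_mono finite_sum_le_infsum) (auto simp: ell2_def)

lemma cmod_le_ell2_norm:
  assumes "v \<in> ell2 X" shows "cmod (v x) \<le> ell2_norm X v"
proof (cases "x \<in> X")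
  case True
  with L2_set_le_ell2_norm[OF assms, of "{x}"] show ?thesis by simp
qed (use assms in \<open>simp add: ell2_outside\<close>)

lemma ell2_mono:
  assumes w: "w \<in> ell2 X" and le: "\<And>x. cmod (v x) \<le> cmod (w x)"
  shows "v \<in> ell2 X" "ell2_norm X v \<le> ell2_norm X w"
proof -
  have out: "v x = 0" if "x \<notin> X" for x
    using le[of x] ell2_outside[OF w that] by simp
  have bd: "L2_set (\<lambda>x. cmod (v x)) F \<le> ell2_norm X w" if "finite F" "F \<subseteq> X" for F
    using L2_set_mono[of F "\<lambda>x. cmod (v x)" "\<lambda>x. cmod (w x)"] le
      L2_set_le_ell2_norm[OF w that] by force
  show "v \<in> ell2 X" "ell2_norm X v \<le> ell2_norm X w"
    using ell2_if_L2_set_le[OF out _ bd] by simp_all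
qed

lemma ell2_zero [simp]: "(\<lambda>_. 0) \<in> ell2 X" and ell2_norm_zero [simp]: "ell2_norm X (\<lambda>_. 0) = 0"
  by (simp_all add: ell2_def ell2_norm_def)

lemma ell2_add:
  assumes v: "v \<in> ell2 X" and w: "w \<in> ell2 X"
  shows "(\<lambda>x. v x + w x) \<in> ell2 X"
    and "ell2_norm X (\<lambda>x. v x + w x) \<le> ell2_norm X v + ell2_norm X w"
proof -
  have bd: "L2_set (\<lambda>x. cmod (v x + w x)) F \<le> ell2_norm X v + ell2_norm X w"
    if F: "finite F" "F \<subseteq> X" for F
  proof -
    have "L2_set (\<lambda>x. cmod (v x + w x)) F \<le> L2_set (\<lambda>x. cmod (v x) + cmod (w x)) F"
      by (intro L2_set_mono norm_triangle_ineq) auto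
    also have "\<dots> \<le> L2_set (\<lambda>x. cmod (v x)) F + L2_set (\<lambda>x. cmod (w x)) F"
      by (rule L2_set_triangle_ineq)
    finally show ?thesis
      using L2_set_le_ell2_norm[OF v F] L2_set_le_ell2_norm[OF w F] by simp
  qed
  have out: "v x + w x = 0" if "x \<notin> X" for x
    using that v w by (simp add: ell2_outside)
  show "(\<lambda>x. v x + w x) \<in> ell2 X"
    "ell2_norm X (\<lambda>x. v x + w x) \<le> ell2_norm X v + ell2_norm X w"
    using ell2_if_L2_set_le[OF out _ bd] by simp_all
qed

lemma ell2_scale:
  assumes v: "v \<in> ell2 X"
  shows "(\<lambda>x. c * v x) \<in> ell2 X"
    and "ell2_norm X (\<lambda>x. c * v x) \<le> cmod c * ell2_norm X v"
proof -
  have bd: "L2_set (\<lambda>x. cmod (c * v x)) F \<le> cmod c * ell2_norm X v"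
    if F: "finite F" "F \<subseteq> X" for F
    using L2_set_le_ell2_norm[OF v F]
    by (simp add: norm_mult L2_set_right_distrib[symmetric] mult_left_mono)
  have out: "c * v x = 0" if "x \<notin> X" for x
    using that v by (simp add: ell2_outside)
  show "(\<lambda>x. c * v x) \<in> ell2 X"
    "ell2_norm X (\<lambda>x. c * v x) \<le> cmod c * ell2_norm X v"
    using ell2_if_L2_set_le[OF out _ bd] by simp_all
qed

lemma inner_finite_le:
  assumes u: "u \<in> ell2 X" and v: "v \<in> ell2 X" and F: "finite F" "F \<subseteq> X"
  shows "(\<Sum>x\<in>F. cmod (u x * cnj (v x))) \<le> ell2_norm X u * ell2_norm X v"
proof -
  have "(\<Sum>x\<in>F. cmod (u x * cnj (v x))) = (\<Sum>x\<in>F. \<bar>cmod (u x)\<bar> * \<bar>cmod (v x)\<bar>)"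
    by (simp add: norm_mult)
  also have "\<dots> \<le> L2_set (\<lambda>x. cmod (u x)) F * L2_set (\<lambda>x. cmod (v x)) F"
    by (rule L2_set_mult_ineq)
  also have "\<dots> \<le> ell2_norm X u * ell2_norm X v"
    using L2_set_le_ell2_norm[OF u F] L2_set_le_ell2_norm[OF v F] by (intro mult_mono) auto
  finally show ?thesis .
qed

lemma inner_abs_summable:
  assumes u: "u \<in> ell2 X" and v: "v \<in> ell2 X"
  shows "(\<lambda>x. u x * cnj (v x)) abs_summable_on X"
  by (rule nonneg_bdd_above_summable_on)
    (use inner_finite_le[OF u v] in \<open>auto intro!: bdd_aboveI2[of _ _ "ell2_norm X u * ell2_norm X v"]\<close>)

lemma inner_has_sum:
  assumes "u \<in> ell2 X" "v \<in> ell2 X"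
  shows "((\<lambda>x. u x * cnj (v x)) has_sum ell2_inner X u v) X"
  unfolding ell2_inner_def
  using abs_summable_summable[OF inner_abs_summable[OF assms]] by (rule has_sum_infsum)

lemma inner_Cauchy_Schwarz:
  assumes u: "u \<in> ell2 X" and v: "v \<in> ell2 X"
  shows "cmod (ell2_inner X u v) \<le> ell2_norm X u * ell2_norm X v"
proof -
  have "cmod (ell2_inner X u v) \<le> (\<Sum>\<^sub>\<infinity>x\<in>X. cmod (u x * cnj (v x)))"
    by (rule norm_infsum_le[OF inner_has_sum[OF u v] has_sum_infsum[OF inner_abs_summable[OF u v]]])
      auto
  also have "\<dots> \<le> ell2_norm X u * ell2_norm X v"
    by (rule infsum_le_finite_sums[OF inner_abs_summable[OF u v]]) (rule inner_finite_le[OF u v])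
  finally show ?thesis .
qed

lemma inner_cnj:
  assumes "u \<in> ell2 X" "v \<in> ell2 X"
  shows "ell2_inner X v u = cnj (ell2_inner X u v)"
proof -
  have "((\<lambda>x. cnj (u x * cnj (v x))) has_sum cnj (ell2_inner X u v)) X"
    using inner_has_sum[OF assms] by (simp only: has_sum_cnj_iff)
  hence "((\<lambda>x. v x * cnj (u x)) has_sum cnj (ell2_inner X u v)) X"
    by (simp add: mult.commute)
  thus ?thesis using inner_has_sum[OF assms(2,1)] has_sum_unique by blast
qed

lemma inner_add_left:
  assumes "u \<in> ell2 X" "v \<in> ell2 X" "w \<in> ell2 X"
  shows "ell2_inner X (\<lambda>x. u x + v x) w = ell2_inner X u w + ell2_inner X v w"
  using has_sum_add[OF inner_has_sum[OF assms(1,3)] inner_has_sum[OF assms(2,3)]]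
    inner_has_sum[OF ell2_add(1)[OF assms(1,2)] assms(3)]
  by (auto simp: distrib_right intro: has_sum_unique)

lemma inner_scale_left:
  assumes "u \<in> ell2 X" "w \<in> ell2 X"
  shows "ell2_inner X (\<lambda>x. c * u x) w = c * ell2_inner X u w"
  using has_sum_cmult_right[OF inner_has_sum[OF assms], of c]
    inner_has_sum[OF ell2_scale(1)[OF assms(1)] assms(2), of c]
  by (auto simp: mult.assoc intro: has_sum_unique)

definition delta :: "'a \<Rightarrow> 'a vec" where
  "delta u = (\<lambda>x. if x = u then 1 else 0)"

definition restr :: "'a set \<Rightarrow> 'a vec \<Rightarrow> 'a vec" where
  "restr A v = (\<lambda>x. if x \<in> A then v x else 0)"

lemma restr_ell2:
  assumes "v \<in> ell2 X"
  shows "restr A v \<in> ell2 X" "ell2_norm X (restr A v) \<le> ell2_norm X v"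
  using ell2_mono[OF assms, of "restr A v"] by (auto simp: restr_def)

lemma delta_ell2 [simp]: "u \<in> X \<Longrightarrow> delta u \<in> ell2 X"
  using has_sum_finite_neutralI[of "{u}" X "\<lambda>x. (cmod (delta u x))\<^sup>2"]
  by (auto simp: ell2_def delta_def summable_on_def)

lemma inner_delta:
  assumes "v \<in> ell2 X" "u \<in> X"
  shows "ell2_inner X v (delta u) = v u"
proof -
  have "((\<lambda>x. v x * cnj (delta u x)) has_sum v u) X"
    by (rule has_sum_finite_neutralI[of "{u}"]) (use assms in \<open>auto simp: delta_def\<close>)
  thus ?thesis using inner_has_sum[OF assms(1) delta_ell2[OF assms(2)]] has_sum_unique by blast
qed

lemma ell2_tail:
  assumes v: "v \<in> ell2 X" and e: "0 < e"
  obtains E where "finite E" "E \<subseteq> X" "\<And>A. A \<inter> E = {} \<Longrightarrow> ell2_norm X (restr A v) < e"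
proof -
  define f where "f = (\<lambda>x. (cmod (v x))\<^sup>2)"
  have summ: "f summable_on X" using v by (simp add: f_def ell2_def)
  obtain E where E: "finite E" "E \<subseteq> X" "dist (sum f E) (infsum f X) \<le> (e/2)\<^sup>2"
    using infsum_finite_approximation[OF summ, of "(e/2)\<^sup>2"] e by auto
  have "ell2_norm X (restr A v) < e" if A: "A \<inter> E = {}" for A
  proof -
    have bd: "L2_set (\<lambda>x. cmod (restr A v x)) F \<le> e/2" if F: "finite F" "F \<subseteq> X" for F
    proof -
      have "sum f (F \<inter> A) + sum f E = sum f ((F \<inter> A) \<union> E)"
        using A F E by (subst sum.union_disjoint) auto
      also have "\<dots> \<le> infsum f X"
        using F E by (intro finite_sum_le_infsum[OF summ]) (auto simp: f_def)
      finally have "sum f (F \<inter> A) \<le> (e/2)\<^sup>2"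
        using E(3) by (simp add: dist_real_def)
      moreover have "(\<Sum>x\<in>F. (cmod (restr A v x))\<^sup>2) = sum f (F \<inter> A)"
        using F by (auto simp: restr_def f_def sum.inter_restrict intro!: sum.cong)
      ultimately have "L2_set (\<lambda>x. cmod (restr A v x)) F \<le> sqrt ((e/2)\<^sup>2)"
        unfolding L2_set_def by (intro real_sqrt_le_mono) simp
      thus ?thesis using e by simp
    qed
    have "ell2_norm X (restr A v) \<le> e/2"
      by (rule ell2_if_L2_set_le(2)[OF _ _ bd]) (use e v in \<open>auto simp: restr_def ell2_outside\<close>)
    thus ?thesis using e by simp
  qed
  with E show thesis by (intro that)
qed

text \<open>
  Finitely supported functions are dense, so a bounded linear functional is a series in its
  values on the point masses.  Applied to the coordinates of \<open>T v\<close>, this lets a bounded operator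
  \<open>T\<close> be treated as the matrix with entries \<open>T (delta u) s\<close>.
\<close>

lemma functional_expansion:
  assumes add: "\<And>v w. v \<in> ell2 X \<Longrightarrow> w \<in> ell2 X \<Longrightarrow> \<phi> (\<lambda>x. v x + w x) = \<phi> v + (\<phi> w :: complex)"
    and scale: "\<And>c v. v \<in> ell2 X \<Longrightarrow> \<phi> (\<lambda>x. c * v x) = c * \<phi> v"
    and bd: "\<And>v. v \<in> ell2 X \<Longrightarrow> cmod (\<phi> v) \<le> C * ell2_norm X v"
    and v: "v \<in> ell2 X"
  shows "((\<lambda>u. v u * \<phi> (delta u)) has_sum \<phi> v) X"
proof -
  have fin: "(\<Sum>u\<in>F. v u * \<phi> (delta u)) = \<phi> (restr F v)" if "finite F" "F \<subseteq> X" for F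
    using that
  proof (induction F rule: finite_induct)
    case empty
    show ?case using scale[OF ell2_zero, of 0] by (simp add: restr_def)
  next
    case (insert a F)
    have eq: "restr (insert a F) v = (\<lambda>x. v a * delta a x + restr F v x)"
      using insert by (auto simp: restr_def delta_def)
    have a: "delta a \<in> ell2 X" using insert by simp
    show ?case
      using insert by (simp add: eq add[OF ell2_scale(1)[OF a] restr_ell2(1)[OF v]] scale[OF a])
  qed
  show ?thesis
    unfolding has_sum_def tendsto_iff eventually_finite_subsets_at_top
  proof (intro allI impI)
    fix e :: real assume e: "0 < e"
    define e' where "e' = e / (\<bar>C\<bar> + 1)"
    have e': "0 < e'" using e by (simp add: e'_def add_pos_nonneg)
    obtain E where E: "finite E" "E \<subseteq> X" "\<And>A. A \<inter> E = {} \<Longrightarrow> ell2_norm X (restr A v) < e'"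
      using ell2_tail[OF v e'] by blast
    have "dist (\<Sum>u\<in>F. v u * \<phi> (delta u)) (\<phi> v) < e"
      if F: "finite F" "E \<subseteq> F" "F \<subseteq> X" for F
    proof -
      have "v = (\<lambda>x. restr F v x + restr (- F) v x)" by (auto simp: restr_def)
      hence "\<phi> v = \<phi> (restr F v) + \<phi> (restr (- F) v)"
        using add[OF restr_ell2(1)[OF v, of F] restr_ell2(1)[OF v, of "- F"]] by simp
      hence "dist (\<Sum>u\<in>F. v u * \<phi> (delta u)) (\<phi> v) = cmod (\<phi> (restr (- F) v))"
        using fin[OF F(1,3)] by (simp add: dist_norm)
      also have "\<dots> \<le> C * ell2_norm X (restr (- F) v)" by (rule bd[OF restr_ell2(1)[OF v]])
      also have "\<dots> \<le> (\<bar>C\<bar> + 1) * ell2_norm X (restr (- F) v)"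
        by (intro mult_right_mono) auto
      also have "\<dots> < (\<bar>C\<bar> + 1) * e'"
        using F by (intro mult_strict_left_mono E(3)) auto
      also have "\<dots> = e" by (simp add: e'_def)
      finally show ?thesis .
    qed
    thus "\<exists>E. finite E \<and> E \<subseteq> X \<and> (\<forall>F. finite F \<and> E \<subseteq> F \<and> F \<subseteq> X \<longrightarrow>
        dist (\<Sum>u\<in>F. v u * \<phi> (delta u)) (\<phi> v) < e)"
      using E by blast
  qed
qed

section \<open>Bounded operators and adjoints\<close>

lemma bounded_opsI:
  assumes "\<And>v. v \<notin> ell2 X \<Longrightarrow> T v = (\<lambda>_. 0)"
    and "\<And>v. v \<in> ell2 X \<Longrightarrow> T v \<in> ell2 X"
    and "\<And>v w. v \<in> ell2 X \<Longrightarrow> w \<in> ell2 X \<Longrightarrow> T (\<lambda>x. v x + w x) = (\<lambda>x. T v x + T w x)"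
    and "\<And>c v. v \<in> ell2 X \<Longrightarrow> T (\<lambda>x. c * v x) = (\<lambda>x. c * T v x)"
    and "\<And>v. v \<in> ell2 X \<Longrightarrow> ell2_norm X (T v) \<le> C * ell2_norm X v"
  shows "T \<in> bounded_ops X"
  unfolding bounded_ops_def using assms by (intro CollectI conjI exI[of _ C]) auto

lemma op_outside: "T \<in> bounded_ops X \<Longrightarrow> v \<notin> ell2 X \<Longrightarrow> T v = (\<lambda>_. 0)"
  and op_ell2: "T \<in> bounded_ops X \<Longrightarrow> v \<in> ell2 X \<Longrightarrow> T v \<in> ell2 X"
  and op_add: "T \<in> bounded_ops X \<Longrightarrow> v \<in> ell2 X \<Longrightarrow> w \<in> ell2 X \<Longrightarrow>
    T (\<lambda>x. v x + w x) = (\<lambda>x. T v x + T w x)"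
  and op_scale: "T \<in> bounded_ops X \<Longrightarrow> v \<in> ell2 X \<Longrightarrow> T (\<lambda>x. c * v x) = (\<lambda>x. c * T v x)"
  by (auto simp: bounded_ops_def)

lemma op_zero: "T \<in> bounded_ops X \<Longrightarrow> T (\<lambda>_. 0) = (\<lambda>_. 0)"
  using op_scale[of T X "\<lambda>_. 0" 0] by simp

lemma op_bound:
  assumes "T \<in> bounded_ops X"
  obtains C where "0 \<le> C" "\<And>v. v \<in> ell2 X \<Longrightarrow> ell2_norm X (T v) \<le> C * ell2_norm X v"
proof -
  obtain C where C: "\<And>v. v \<in> ell2 X \<Longrightarrow> ell2_norm X (T v) \<le> C * ell2_norm X v"
    using assms unfolding bounded_ops_def by blast
  have "ell2_norm X (T v) \<le> \<bar>C\<bar> * ell2_norm X v" if "v \<in> ell2 X" for v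
    using C[OF that] mult_right_mono[OF abs_ge_self ell2_norm_nonneg, of C X v] by linarith
  thus thesis by (intro that[of "\<bar>C\<bar>"]) auto
qed

lemma op_expansion:
  assumes T: "T \<in> bounded_ops X" and v: "v \<in> ell2 X"
  shows "((\<lambda>u. v u * T (delta u) s) has_sum T v s) X"
proof -
  obtain C where C: "\<And>v. v \<in> ell2 X \<Longrightarrow> ell2_norm X (T v) \<le> C * ell2_norm X v"
    using op_bound[OF T] by blast
  show ?thesis
  proof (rule functional_expansion[OF _ _ _ v])
    fix w assume w: "w \<in> ell2 X"
    show "cmod (T w s) \<le> C * ell2_norm X w"
      using cmod_le_ell2_norm[OF op_ell2[OF T w], of s] C[OF w] by simp
  qed (simp_all add: op_add[OF T] op_scale[OF T])
qed

lemma op_eqI: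
  assumes T: "T \<in> bounded_ops X" and S: "S \<in> bounded_ops X"
    and eq: "\<And>u s. u \<in> X \<Longrightarrow> s \<in> X \<Longrightarrow> T (delta u) s = S (delta u) s"
  shows "T = S"
proof
  fix v
  show "T v = S v"
  proof (cases "v \<in> ell2 X")
    case v: True
    show ?thesis
    proof
      fix s
      show "T v s = S v s"
      proof (cases "s \<in> X")
        case True
        have "((\<lambda>u. v u * T (delta u) s) has_sum S v s) X"
          using op_expansion[OF S v, of s] has_sum_cong[of X "\<lambda>u. v u * T (delta u) s"
              "\<lambda>u. v u * S (delta u) s"] eq True by auto
        thus ?thesis using op_expansion[OF T v, of s] has_sum_unique by blast
      next
        case False
        thus ?thesis
          using op_ell2[OF T v] op_ell2[OF S v] by (simp add: ell2_outside)
      qed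
    qed
  qed (simp add: op_outside[OF T] op_outside[OF S])
qed

lemma inner_op_expansion:
  assumes T: "T \<in> bounded_ops X" and v: "v \<in> ell2 X" and w: "w \<in> ell2 X"
  shows "((\<lambda>u. v u * ell2_inner X (T (delta u)) w) has_sum ell2_inner X (T v) w) X"
proof -
  obtain C where C: "\<And>v. v \<in> ell2 X \<Longrightarrow> ell2_norm X (T v) \<le> C * ell2_norm X v"
    using op_bound[OF T] by blast
  show ?thesis
  proof (rule functional_expansion[OF _ _ _ v])
    fix u assume u: "u \<in> ell2 X"
    have "cmod (ell2_inner X (T u) w) \<le> ell2_norm X (T u) * ell2_norm X w"
      by (rule inner_Cauchy_Schwarz[OF op_ell2[OF T u] w])
    also have "\<dots> \<le> (C * ell2_norm X w) * ell2_norm X u"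
      using mult_right_mono[OF C[OF u], of "ell2_norm X w"] by (simp add: mult_ac)
    finally show "cmod (ell2_inner X (T u) w) \<le> (C * ell2_norm X w) * ell2_norm X u" .
  next
    fix u u' assume "u \<in> ell2 X" "u' \<in> ell2 X"
    thus "ell2_inner X (T (\<lambda>x. u x + u' x)) w = ell2_inner X (T u) w + ell2_inner X (T u') w"
      by (simp add: op_add[OF T] inner_add_left op_ell2[OF T] w)
  next
    fix c u assume "u \<in> ell2 X"
    thus "ell2_inner X (T (\<lambda>x. c * u x)) w = c * ell2_inner X (T u) w"
      by (simp add: op_scale[OF T] inner_scale_left op_ell2[OF T] w)
  qed
qed

lemma zero_bounded: "(\<lambda>_ _. 0) \<in> bounded_ops X"
  by (rule bounded_opsI[where C = 0]) auto

lemma comp_bounded: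
  assumes T: "T \<in> bounded_ops X" and S: "S \<in> bounded_ops X"
  shows "T \<circ> S \<in> bounded_ops X"
proof -
  obtain C where C: "0 \<le> C" "\<And>v. v \<in> ell2 X \<Longrightarrow> ell2_norm X (T v) \<le> C * ell2_norm X v"
    using op_bound[OF T] by blast
  obtain D where D: "\<And>v. v \<in> ell2 X \<Longrightarrow> ell2_norm X (S v) \<le> D * ell2_norm X v"
    using op_bound[OF S] by blast
  show ?thesis
  proof (rule bounded_opsI)
    fix v assume v: "v \<in> ell2 X"
    have "ell2_norm X (T (S v)) \<le> C * ell2_norm X (S v)" by (rule C(2)[OF op_ell2[OF S v]])
    also have "\<dots> \<le> C * (D * ell2_norm X v)" by (rule mult_left_mono[OF D[OF v] C(1)])
    finally show "ell2_norm X ((T \<circ> S) v) \<le> (C * D) * ell2_norm X v" by (simp add: mult_ac)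
  qed (simp_all add: op_outside[OF S] op_zero[OF T] op_ell2[OF T] op_ell2[OF S] op_add[OF T]
      op_add[OF S] op_scale[OF T] op_scale[OF S])
qed

lemma add_bounded:
  assumes T: "T \<in> bounded_ops X" and S: "S \<in> bounded_ops X"
  shows "(\<lambda>v x. T v x + S v x) \<in> bounded_ops X"
proof -
  obtain C where C: "\<And>v. v \<in> ell2 X \<Longrightarrow> ell2_norm X (T v) \<le> C * ell2_norm X v"
    using op_bound[OF T] by blast
  obtain D where D: "\<And>v. v \<in> ell2 X \<Longrightarrow> ell2_norm X (S v) \<le> D * ell2_norm X v"
    using op_bound[OF S] by blast
  show ?thesis
  proof (rule bounded_opsI)
    fix v assume v: "v \<in> ell2 X"
    show "ell2_norm X (\<lambda>x. T v x + S v x) \<le> (C + D) * ell2_norm X v"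
      using ell2_add(2)[OF op_ell2[OF T v] op_ell2[OF S v]] C[OF v] D[OF v]
      by (simp add: distrib_right)
  qed (simp_all add: op_outside[OF T] op_outside[OF S] op_ell2[OF T] op_ell2[OF S] op_add[OF T]
      op_add[OF S] op_scale[OF T] op_scale[OF S] ell2_add distrib_left add_ac)
qed

lemma sum_bounded_ops:
  assumes "finite F" "\<And>i. i \<in> F \<Longrightarrow> T i \<in> bounded_ops X"
  shows "(\<lambda>v x. \<Sum>i\<in>F. T i v x) \<in> bounded_ops X"
  using assms by (induction F rule: finite_induct) (simp_all add: zero_bounded add_bounded)

text \<open>
  The adjoint is written down directly, by its matrix.  That it maps into the Hilbert space
  is the usual duality estimate: the squared norm of the restriction
  of \<open>adj X T w\<close> to a finite set is the inner product of \<open>w\<close> with the image under \<open>T\<close> of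
  that restriction.
\<close>

definition adj :: "'a set \<Rightarrow> 'a oper \<Rightarrow> 'a oper" where
  "adj X T = (\<lambda>w u. if w \<in> ell2 X \<and> u \<in> X then ell2_inner X w (T (delta u)) else 0)"

lemma adj_ell2_bound:
  assumes T: "T \<in> bounded_ops X" and w: "w \<in> ell2 X"
    and C: "0 \<le> C" "\<And>v. v \<in> ell2 X \<Longrightarrow> ell2_norm X (T v) \<le> C * ell2_norm X v"
  shows "adj X T w \<in> ell2 X" "ell2_norm X (adj X T w) \<le> C * ell2_norm X w"
proof -
  let ?a = "adj X T w"
  have bd: "L2_set (\<lambda>x. cmod (?a x)) F \<le> C * ell2_norm X w" if F: "finite F" "F \<subseteq> X" for F
  proof -
    define l where "l = L2_set (\<lambda>x. cmod (?a x)) F"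
    define r where "r = restr F ?a"
    have l0: "0 \<le> l" by (simp add: l_def)
    have l2: "l\<^sup>2 = (\<Sum>x\<in>F. (cmod (?a x))\<^sup>2)" by (simp add: l_def L2_set_def sum_nonneg)
    have r_bd: "L2_set (\<lambda>x. cmod (r x)) F' \<le> l" if "finite F'" "F' \<subseteq> X" for F'
    proof -
      have "(\<Sum>x\<in>F'. (cmod (r x))\<^sup>2) = (\<Sum>x\<in>F' \<inter> F. (cmod (?a x))\<^sup>2)"
        using that by (auto simp: r_def restr_def sum.inter_restrict intro!: sum.cong)
      also have "\<dots> \<le> (\<Sum>x\<in>F. (cmod (?a x))\<^sup>2)" by (rule sum_mono2) (use F in auto)
      finally show ?thesis unfolding l_def L2_set_def by (rule real_sqrt_le_mono)
    qed
    have r0: "r x = 0" if "x \<notin> X" for x using that F by (auto simp: r_def restr_def)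
    have r: "r \<in> ell2 X" and rl: "ell2_norm X r \<le> l"
      using ell2_if_L2_set_le[OF r0 l0 r_bd] by auto
    have aF: "cnj (ell2_inner X (T (delta u)) w) = ?a u" if "u \<in> X" for u
      using that w by (simp add: adj_def inner_cnj[OF op_ell2[OF T delta_ell2[OF that]] w])
    have "((\<lambda>u. r u * ell2_inner X (T (delta u)) w) has_sum ell2_inner X (T r) w) X"
      by (rule inner_op_expansion[OF T r w])
    moreover have "((\<lambda>u. r u * ell2_inner X (T (delta u)) w) has_sum of_real (l\<^sup>2)) X"
    proof (rule has_sum_finite_neutralI[of F])
      have "(\<Sum>u\<in>F. r u * ell2_inner X (T (delta u)) w)
          = (\<Sum>u\<in>F. ?a u * cnj (?a u))"
        using F aF by (intro sum.cong refl) (auto simp: r_def restr_def simp flip: aF)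
      also have "\<dots> = of_real (l\<^sup>2)"
        by (simp only: l2 complex_norm_square of_real_sum)
      finally show "complex_of_real (l\<^sup>2) = (\<Sum>u\<in>F. r u * ell2_inner X (T (delta u)) w)" by simp
    qed (use F in \<open>auto simp: r_def restr_def\<close>)
    ultimately have "of_real (l\<^sup>2) = ell2_inner X (T r) w" using has_sum_unique by blast
    hence "l\<^sup>2 = cmod (ell2_inner X (T r) w)"
      by (metis norm_of_real abs_power2)
    also have "\<dots> \<le> ell2_norm X (T r) * ell2_norm X w"
      by (rule inner_Cauchy_Schwarz[OF op_ell2[OF T r] w])
    also have "\<dots> \<le> (C * l) * ell2_norm X w"
      using C(2)[OF r] mult_left_mono[OF rl C(1)] by (intro mult_right_mono) auto
    finally have *: "l * l \<le> l * (C * ell2_norm X w)" by (simp add: power2_eq_square mult_ac)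
    show ?thesis
    proof (cases "l = 0")
      case True
      thus ?thesis using C(1) unfolding l_def by simp
    next
      case False
      hence "0 < l" using l0 by simp
      thus ?thesis using * unfolding l_def by simp
    qed
  qed
  show "?a \<in> ell2 X" "ell2_norm X ?a \<le> C * ell2_norm X w"
    using ell2_if_L2_set_le[OF _ _ bd] C(1) by (auto simp: adj_def)
qed

lemma adj_bounded:
  assumes T: "T \<in> bounded_ops X"
  shows "adj X T \<in> bounded_ops X"
proof -
  obtain C where C: "0 \<le> C" "\<And>v. v \<in> ell2 X \<Longrightarrow> ell2_norm X (T v) \<le> C * ell2_norm X v"
    using op_bound[OF T] by blast
  show ?thesis
  proof (rule bounded_opsI)
    fix w assume w: "w \<in> ell2 X"
    show "adj X T w \<in> ell2 X" "ell2_norm X (adj X T w) \<le> C * ell2_norm X w"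
      using adj_ell2_bound[OF T w C] by auto
  next
    fix v w assume "v \<in> ell2 X" "w \<in> ell2 X"
    thus "adj X T (\<lambda>x. v x + w x) = (\<lambda>x. adj X T v x + adj X T w x)"
      by (auto simp: adj_def ell2_add inner_add_left op_ell2[OF T])
  next
    fix c v assume "v \<in> ell2 X"
    thus "adj X T (\<lambda>x. c * v x) = (\<lambda>x. c * adj X T v x)"
      by (auto simp: adj_def ell2_scale inner_scale_left op_ell2[OF T])
  qed (auto simp: adj_def)
qed

lemma adj_is_adjoint:
  assumes T: "T \<in> bounded_ops X"
  shows "is_adjoint X T (adj X T)"
  unfolding is_adjoint_def
proof (intro ballI)
  fix v w assume v: "v \<in> ell2 X" and w: "w \<in> ell2 X"
  have "((\<lambda>u. v u * cnj (adj X T w u)) has_sum ell2_inner X (T v) w) X"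
    using inner_op_expansion[OF T v w]
  proof (subst (asm) has_sum_cong)
    fix u assume "u \<in> X"
    thus "v u * ell2_inner X (T (delta u)) w = v u * cnj (adj X T w u)"
      using w by (simp add: adj_def inner_cnj[OF w op_ell2[OF T delta_ell2]])
  qed
  thus "ell2_inner X (T v) w = ell2_inner X v (adj X T w)"
    using inner_has_sum[OF v op_ell2[OF adj_bounded[OF T] w]] has_sum_unique by blast
qed

lemma adj_matrix:
  assumes T: "T \<in> bounded_ops X" and u: "u \<in> X" and s: "s \<in> X"
  shows "adj X T (delta u) s = cnj (T (delta s) u)"
  using assms
  by (simp add: adj_def inner_cnj[of "T (delta s)" X "delta u"] op_ell2[OF T] inner_delta)

text \<open>
  Uniqueness transfers the abstract adjoint in the definition of a von Neumann algebra to the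
  concrete one.
\<close>

lemma is_adjoint_unique:
  assumes T: "T \<in> bounded_ops X" and S: "S \<in> bounded_ops X" and a: "is_adjoint X T S"
  shows "S = adj X T"
proof (rule op_eqI[OF S adj_bounded[OF T]])
  fix u s assume us: "u \<in> X" "s \<in> X"
  have "T (delta s) u = ell2_inner X (T (delta s)) (delta u)"
    using us by (simp add: inner_delta op_ell2[OF T])
  also have "\<dots> = ell2_inner X (delta s) (S (delta u))"
    using a us by (simp add: is_adjoint_def)
  also have "\<dots> = cnj (S (delta u) s)"
    using us by (simp add: inner_cnj[of "S (delta u)" X "delta s"] op_ell2[OF S] inner_delta)
  finally show "S (delta u) s = adj X T (delta u) s"
    using us by (simp add: adj_matrix[OF T])
qed

lemma adj_adj:
  assumes T: "T \<in> bounded_ops X" shows "adj X (adj X T) = T"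
  by (rule op_eqI[OF adj_bounded[OF adj_bounded[OF T]] T])
    (simp add: adj_matrix T adj_bounded)

lemma adj_comp:
  assumes T: "T \<in> bounded_ops X" and S: "S \<in> bounded_ops X"
  shows "adj X (T \<circ> S) = adj X S \<circ> adj X T"
proof (rule is_adjoint_unique[symmetric])
  show "is_adjoint X (T \<circ> S) (adj X S \<circ> adj X T)"
    using adj_is_adjoint[OF T] adj_is_adjoint[OF S]
    by (simp add: is_adjoint_def op_ell2[OF S] op_ell2[OF adj_bounded[OF T]])
qed (simp_all add: comp_bounded adj_bounded T S)

lemma adj_sum:
  assumes F: "finite F" and T: "\<And>i. i \<in> F \<Longrightarrow> T i \<in> bounded_ops X"
  shows "adj X (\<lambda>v x. \<Sum>i\<in>F. T i v x) = (\<lambda>v x. \<Sum>i\<in>F. adj X (T i) v x)"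
  by (rule op_eqI[where X = X])
    (simp_all add: sum_bounded_ops F T adj_bounded adj_matrix)

section \<open>Commutants and von Neumann algebras\<close>

lemma commutant_bounded: "commutant X S \<subseteq> bounded_ops X"
  by (auto simp: commutant_def)

lemma commutant_antimono: "S \<subseteq> S' \<Longrightarrow> commutant X S' \<subseteq> commutant X S"
  by (auto simp: commutant_def)

lemma subset_bicommutant: "S \<subseteq> bounded_ops X \<Longrightarrow> S \<subseteq> commutant X (commutant X S)"
  by (auto simp: commutant_def)

lemma commutant_comp:
  assumes T: "T \<in> commutant X A" and S: "S \<in> commutant X A"
  shows "T \<circ> S \<in> commutant X A"
proof -
  have "(T \<circ> S) \<circ> B = B \<circ> (T \<circ> S)" if "B \<in> A" for B
  proof -
    have "T \<circ> B = B \<circ> T" "S \<circ> B = B \<circ> S" using that T S by (auto simp: commutant_def)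
    thus ?thesis by (metis comp_assoc)
  qed
  thus ?thesis using T S by (simp add: commutant_def comp_bounded)
qed

lemma commutant_zero: "S \<subseteq> bounded_ops X \<Longrightarrow> (\<lambda>_ _. 0) \<in> commutant X S"
  by (auto simp: commutant_def zero_bounded comp_def op_zero)

lemma commutant_adj:
  assumes S: "S \<subseteq> bounded_ops X" and adjS: "\<And>A. A \<in> S \<Longrightarrow> adj X A \<in> S"
    and T: "T \<in> commutant X S"
  shows "adj X T \<in> commutant X S"
proof -
  have Tb: "T \<in> bounded_ops X" using T by (simp add: commutant_def)
  have "adj X T \<circ> A = A \<circ> adj X T" if A: "A \<in> S" for A
  proof -
    have Ab: "A \<in> bounded_ops X" using A S by auto
    have "T \<circ> adj X A = adj X A \<circ> T" using T adjS[OF A] by (simp add: commutant_def)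
    hence "adj X (T \<circ> adj X A) = adj X (adj X A \<circ> T)" by simp
    thus ?thesis by (simp add: adj_comp Tb Ab adj_bounded adj_adj)
  qed
  thus ?thesis by (simp add: commutant_def adj_bounded Tb)
qed

text \<open>
  Commutants of self-adjoint sets are self-adjoint, and a triple commutant is a commutant.
\<close>

lemma von_Neumann_algebra_bicommutant:
  assumes S: "S \<subseteq> bounded_ops X" and adjS: "\<And>A. A \<in> S \<Longrightarrow> adj X A \<in> S"
  shows "von_Neumann_algebra X (commutant X (commutant X S))"
proof -
  let ?M = "commutant X (commutant X S)"
  have "\<exists>S\<in>?M. is_adjoint X T S" if T: "T \<in> ?M" for T
  proof
    show "adj X T \<in> ?M"
      by (rule commutant_adj[OF commutant_bounded _ T]) (rule commutant_adj[OF S adjS])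
    show "is_adjoint X T (adj X T)"
      using T by (intro adj_is_adjoint) (simp add: commutant_def)
  qed
  moreover have "commutant X (commutant X ?M) = ?M"
    by (meson commutant_antimono commutant_bounded subset_antisym subset_bicommutant)
  ultimately show ?thesis by (simp add: von_Neumann_algebra_def commutant_bounded)
qed

lemma von_Neumann_algebra_adj:
  assumes M: "von_Neumann_algebra X M" and T: "T \<in> M"
  shows "adj X T \<in> M"
proof -
  obtain S where "S \<in> M" "is_adjoint X T S" "M \<subseteq> bounded_ops X"
    using M T by (auto simp: von_Neumann_algebra_def)
  thus ?thesis using is_adjoint_unique[of T X S] T by auto
qed

lemma von_Neumann_algebra_comp:
  assumes "von_Neumann_algebra X M" "T \<in> M" "S \<in> M"
  shows "T \<circ> S \<in> M"
  using assms commutant_comp[of T X "commutant X M" S] by (simp add: von_Neumann_algebra_def)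

lemma subset_vN_generated: "S \<subseteq> vN_generated X S"
  by (auto simp: vN_generated_def)

lemma vN_generated_least: "von_Neumann_algebra X M \<Longrightarrow> S \<subseteq> M \<Longrightarrow> vN_generated X S \<subseteq> M"
  by (auto simp: vN_generated_def)

text \<open>
  For a self-adjoint set the double commutant is the smallest von Neumann algebra containing it,
  so that \<open>L(K)\<close>, defined as an intersection, can be tested by commutation.
\<close>

lemma vN_generated_eq_bicommutant:
  assumes S: "S \<subseteq> bounded_ops X" and adjS: "\<And>A. A \<in> S \<Longrightarrow> adj X A \<in> S"
  shows "vN_generated X S = commutant X (commutant X S)"
proof
  show "vN_generated X S \<subseteq> commutant X (commutant X S)"
    by (rule vN_generated_least[OF von_Neumann_algebra_bicommutant[OF S adjS] subset_bicommutant[OF S]])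
  have "commutant X (commutant X S) \<subseteq> M" if "von_Neumann_algebra X M" "S \<subseteq> M" for M
    using that commutant_antimono[OF commutant_antimono[OF that(2), of X], of X]
    by (auto simp: von_Neumann_algebra_def)
  thus "commutant X (commutant X S) \<subseteq> vN_generated X S"
    by (auto simp: vN_generated_def)
qed

section \<open>The group von Neumann algebra as an algebra of convolution operators\<close>

lemma ell2_reindex:
  assumes \<sigma>: "inj_on \<sigma> X" "\<sigma> ` X \<subseteq> X" and v: "v \<in> ell2 X"
  shows "(\<lambda>x. if x \<in> X then v (\<sigma> x) else 0) \<in> ell2 X"
    and "ell2_norm X (\<lambda>x. if x \<in> X then v (\<sigma> x) else 0) \<le> ell2_norm X v"
proof -
  let ?w = "\<lambda>x. if x \<in> X then v (\<sigma> x) else 0"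
  have bd: "L2_set (\<lambda>x. cmod (?w x)) F \<le> ell2_norm X v" if F: "finite F" "F \<subseteq> X" for F
  proof -
    have "inj_on \<sigma> F" using \<sigma>(1) F(2) inj_on_subset by blast
    hence "(\<Sum>y\<in>\<sigma> ` F. (cmod (v y))\<^sup>2) = (\<Sum>x\<in>F. (cmod (v (\<sigma> x)))\<^sup>2)"
      by (simp add: sum.reindex)
    also have "\<dots> = (\<Sum>x\<in>F. (cmod (?w x))\<^sup>2)"
      using F by (intro sum.cong) auto
    finally have "L2_set (\<lambda>x. cmod (?w x)) F = L2_set (\<lambda>y. cmod (v y)) (\<sigma> ` F)"
      by (simp add: L2_set_def)
    also have "\<dots> \<le> ell2_norm X v"
      using F \<sigma>(2) by (intro L2_set_le_ell2_norm[OF v]) auto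
    finally show ?thesis .
  qed
  show "?w \<in> ell2 X" "ell2_norm X ?w \<le> ell2_norm X v"
    using ell2_if_L2_set_le[OF _ _ bd] by auto
qed

context group
begin

lemma left_regular_ell2:
  assumes g: "g \<in> carrier G" and v: "v \<in> ell2 (carrier G)"
  shows "left_regular G g v \<in> ell2 (carrier G)"
    and "ell2_norm (carrier G) (left_regular G g v) \<le> ell2_norm (carrier G) v"
proof -
  have "inj_on (\<lambda>x. inv g \<otimes> x) (carrier G)" "(\<lambda>x. inv g \<otimes> x) ` carrier G \<subseteq> carrier G"
    using g by (auto simp: inj_on_def)
  from ell2_reindex[OF this v]
  show "left_regular G g v \<in> ell2 (carrier G)"
    "ell2_norm (carrier G) (left_regular G g v) \<le> ell2_norm (carrier G) v"
    using v by (simp_all add: left_regular_def)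
qed

lemma left_regular_bounded:
  assumes g: "g \<in> carrier G"
  shows "left_regular G g \<in> bounded_ops (carrier G)"
proof (rule bounded_opsI[where C = 1])
  fix v assume v: "v \<in> ell2 (carrier G)"
  show "left_regular G g v \<in> ell2 (carrier G)" by (rule left_regular_ell2(1)[OF g v])
  show "ell2_norm (carrier G) (left_regular G g v) \<le> 1 * ell2_norm (carrier G) v"
    using left_regular_ell2(2)[OF g v] by simp
qed (auto simp: left_regular_def ell2_add ell2_scale)

lemma left_regular_apply:
  "v \<in> ell2 (carrier G) \<Longrightarrow> x \<in> carrier G \<Longrightarrow> left_regular G g v x = v (inv g \<otimes> x)"
  by (simp add: left_regular_def)

lemma left_regular_delta:
  assumes g: "g \<in> carrier G" and u: "u \<in> carrier G"
  shows "left_regular G g (delta u) = delta (g \<otimes> u)"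
proof
  fix x
  have "inv g \<otimes> x = u \<longleftrightarrow> x = g \<otimes> u" if "x \<in> carrier G"
    using g u that by (metis inv_closed inv_inv inv_solve_left m_closed)
  thus "left_regular G g (delta u) x = delta (g \<otimes> u) x"
    using g u delta_ell2[OF u] by (simp add: left_regular_def) (auto simp: delta_def)
qed

lemma left_regular_comp:
  assumes "g \<in> carrier G" "h \<in> carrier G"
  shows "left_regular G g \<circ> left_regular G h = left_regular G (g \<otimes> h)"
  by (rule op_eqI[where X = "carrier G"])
    (use assms in \<open>simp_all add: comp_bounded left_regular_bounded left_regular_delta m_assoc\<close>)

lemma adj_left_regular:
  assumes g: "g \<in> carrier G"
  shows "adj (carrier G) (left_regular G g) = left_regular G (inv g)"
proof (rule op_eqI)
  fix u s assume us: "u \<in> carrier G" "s \<in> carrier G"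
  have "u = g \<otimes> s \<longleftrightarrow> s = inv g \<otimes> u"
    using g us by (metis inv_closed inv_inv inv_solve_left m_closed)
  thus "adj (carrier G) (left_regular G g) (delta u) s = left_regular G (inv g) (delta u) s"
    using g us by (simp add: adj_matrix left_regular_bounded left_regular_delta) (simp add: delta_def)
qed (simp_all add: g adj_bounded left_regular_bounded)

lemma left_regular_inj: "inj_on (left_regular G) (carrier G)"
proof (rule inj_onI)
  fix g h assume gh: "g \<in> carrier G" "h \<in> carrier G" "left_regular G g = left_regular G h"
  hence "delta g g = delta h g"
    using left_regular_delta[of g \<one>] left_regular_delta[of h \<one>] by simp
  thus "g = h" by (simp add: delta_def split: if_splits)
qed

definition right_translation :: "'a \<Rightarrow> 'a oper" where
  "right_translation t = (\<lambda>v x. if v \<in> ell2 (carrier G) \<and> x \<in> carrier G then v (x \<otimes> t) else 0)"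

lemma right_translation_bounded:
  assumes t: "t \<in> carrier G"
  shows "right_translation t \<in> bounded_ops (carrier G)"
proof (rule bounded_opsI[where C = 1])
  fix v assume v: "v \<in> ell2 (carrier G)"
  have "inj_on (\<lambda>x. x \<otimes> t) (carrier G)" "(\<lambda>x. x \<otimes> t) ` carrier G \<subseteq> carrier G"
    using t by (auto simp: inj_on_def)
  from ell2_reindex[OF this v]
  show "right_translation t v \<in> ell2 (carrier G)"
    "ell2_norm (carrier G) (right_translation t v) \<le> 1 * ell2_norm (carrier G) v"
    using v by (simp_all add: right_translation_def)
qed (auto simp: right_translation_def ell2_add ell2_scale)

lemma right_translation_delta:
  assumes t: "t \<in> carrier G" and u: "u \<in> carrier G"
  shows "right_translation (inv t) (delta u) = delta (u \<otimes> t)"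
proof
  fix x
  have "x \<otimes> inv t = u \<longleftrightarrow> x = u \<otimes> t" if "x \<in> carrier G"
    using t u that by (metis inv_closed inv_inv inv_solve_right m_closed)
  thus "right_translation (inv t) (delta u) x = delta (u \<otimes> t) x"
    using t u delta_ell2[OF u] by (simp add: right_translation_def) (auto simp: delta_def)
qed

lemma right_translation_commutes:
  assumes "t \<in> carrier G" "g \<in> carrier G"
  shows "right_translation (inv t) \<circ> left_regular G g = left_regular G g \<circ> right_translation (inv t)"
  by (rule op_eqI[where X = "carrier G"])
    (use assms in \<open>simp_all add: comp_bounded left_regular_bounded right_translation_bounded
      left_regular_delta right_translation_delta m_assoc\<close>)

lemma left_regular_image_bounded:
  "K \<subseteq> carrier G \<Longrightarrow> left_regular G ` K \<subseteq> bounded_ops (carrier G)"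
  by (auto intro: left_regular_bounded)

lemma adj_left_regular_image:
  assumes "subgroup K G" "A \<in> left_regular G ` K"
  shows "adj (carrier G) A \<in> left_regular G ` K"
  using assms subgroup.m_inv_closed[OF assms(1)] subgroup.subset[OF assms(1)]
  by (auto simp: adj_left_regular subset_iff)

lemma group_vNa_eq_bicommutant:
  assumes K: "subgroup K G"
  shows "group_vNa G K = commutant (carrier G) (commutant (carrier G) (left_regular G ` K))"
  unfolding group_vNa_def
  by (rule vN_generated_eq_bicommutant[OF left_regular_image_bounded adj_left_regular_image])
    (use K subgroup.subset[OF K] in auto)

lemma group_vNa_von_Neumann_algebra:
  assumes K: "subgroup K G"
  shows "von_Neumann_algebra (carrier G) (group_vNa G K)"
  unfolding group_vNa_eq_bicommutant[OF K]
  by (rule von_Neumann_algebra_bicommutant[OF left_regular_image_bounded adj_left_regular_image])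
    (use K subgroup.subset[OF K] in auto)

lemma group_vNa_bounded: "subgroup K G \<Longrightarrow> x \<in> group_vNa G K \<Longrightarrow> x \<in> bounded_ops (carrier G)"
  using group_vNa_von_Neumann_algebra by (auto simp: von_Neumann_algebra_def)

lemma left_regular_in_group_vNa: "k \<in> K \<Longrightarrow> left_regular G k \<in> group_vNa G K"
  unfolding group_vNa_def using subset_vN_generated by fast

lemma group_vNa_subset_carrier:
  assumes K: "subgroup K G"
  shows "group_vNa G K \<subseteq> group_vNa G (carrier G)"
  unfolding group_vNa_eq_bicommutant[OF K] group_vNa_eq_bicommutant[OF subgroup_self]
  by (intro commutant_antimono image_mono subgroup.subset[OF K])

lemma zero_in_group_vNa:
  assumes K: "subgroup K G" shows "(\<lambda>_ _. 0) \<in> group_vNa G K"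
  unfolding group_vNa_eq_bicommutant[OF K] by (rule commutant_zero[OF commutant_bounded])

text \<open>
  An element of \<open>L(G)\<close> commutes with right translations, so its matrix entry at \<open>(s, u)\<close>
  depends only on \<open>s u\<^sup>-\<^sup>1\<close>: it is left convolution by the function \<open>x \<delta>\<^sub>1\<close>.
\<close>

lemma group_vNa_matrix:
  assumes x: "x \<in> group_vNa G (carrier G)" and u: "u \<in> carrier G" and s: "s \<in> carrier G"
  shows "x (delta u) s = x (delta \<one>) (s \<otimes> inv u)"
proof -
  let ?R = "right_translation (inv u)"
  have xb: "x \<in> bounded_ops (carrier G)" by (rule group_vNa_bounded[OF subgroup_self x])
  have "?R \<in> commutant (carrier G) (left_regular G ` carrier G)"
    using u right_translation_commutes by (auto simp: commutant_def right_translation_bounded)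
  hence "x \<circ> ?R = ?R \<circ> x"
    using x by (simp add: group_vNa_eq_bicommutant[OF subgroup_self] commutant_def)
  hence "x (?R (delta \<one>)) s = ?R (x (delta \<one>)) s"
    by (metis comp_apply)
  thus ?thesis
    using u s by (simp add: right_translation_delta)
      (simp add: right_translation_def op_ell2[OF xb])
qed

text \<open>
  Conversely, a bounded convolution operator whose function is supported in \<open>K\<close> commutes with
  every operator \<open>T\<close> that commutes with \<open>K\<close>, since the matrix of \<open>T\<close> is invariant under the
  diagonal left action of \<open>K\<close>: the substitution \<open>w \<mapsto> s w\<^sup>-\<^sup>1 u\<close> turns the series for one
  product into the series for the other.
\<close>

lemma convolution_operator_in_group_vNa:
  assumes K: "subgroup K G" and y: "y \<in> bounded_ops (carrier G)"
    and mat: "\<And>u s. u \<in> carrier G \<Longrightarrow> s \<in> carrier G \<Longrightarrow> y (delta u) s = \<phi> (s \<otimes> inv u)"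
    and supp: "\<And>z. z \<in> carrier G \<Longrightarrow> z \<notin> K \<Longrightarrow> \<phi> z = 0"
  shows "y \<in> group_vNa G K"
proof -
  have "y \<circ> T = T \<circ> y" if T: "T \<in> commutant (carrier G) (left_regular G ` K)" for T
  proof -
    have Tb: "T \<in> bounded_ops (carrier G)" using T by (simp add: commutant_def)
    have inv_T: "T (delta (k \<otimes> u)) (k \<otimes> s) = T (delta u) s"
      if k: "k \<in> K" and us: "u \<in> carrier G" "s \<in> carrier G" for k u s
    proof -
      have kG: "k \<in> carrier G" using K k subgroup.subset by blast
      have "T \<circ> left_regular G k = left_regular G k \<circ> T" using T k by (simp add: commutant_def)
      hence "T (left_regular G k (delta u)) (k \<otimes> s) = left_regular G k (T (delta u)) (k \<otimes> s)"
        by (metis comp_apply)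
      moreover have "inv k \<otimes> (k \<otimes> s) = s"
        using kG us by (simp add: m_assoc[symmetric])
      ultimately show ?thesis
        using kG us by (simp add: left_regular_delta left_regular_apply op_ell2[OF Tb])
    qed
    show ?thesis
    proof (rule op_eqI[OF comp_bounded[OF y Tb] comp_bounded[OF Tb y]])
      fix u s assume us: "u \<in> carrier G" "s \<in> carrier G"
      let ?\<sigma> = "\<lambda>w. s \<otimes> inv w \<otimes> u"
      have \<sigma>\<sigma>: "?\<sigma> w \<otimes> inv u = s \<otimes> inv w" if "w \<in> carrier G" for w
        using us that by (simp add: m_assoc)
      have bij: "bij_betw ?\<sigma> (carrier G) (carrier G)"
      proof (rule bij_betw_byWitness[where f' = "\<lambda>w. u \<otimes> inv w \<otimes> s"])
        show "\<forall>w\<in>carrier G. u \<otimes> inv (s \<otimes> inv w \<otimes> u) \<otimes> s = w"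
          "\<forall>w\<in>carrier G. s \<otimes> inv (u \<otimes> inv w \<otimes> s) \<otimes> u = w"
          using us by (simp_all add: inv_mult_group m_assoc) (simp_all add: m_assoc[symmetric])
      qed (use us in auto)
      have eq: "y (delta u) (?\<sigma> w) * T (delta (?\<sigma> w)) s = T (delta u) w * y (delta w) s"
        if w: "w \<in> carrier G" for w
      proof (cases "s \<otimes> inv w \<in> K")
        case True
        have "T (delta (s \<otimes> inv w \<otimes> u)) (s \<otimes> inv w \<otimes> w) = T (delta u) w"
          by (rule inv_T[OF True us(1) w])
        moreover have "s \<otimes> inv w \<otimes> w = s" using us w by (simp add: m_assoc)
        ultimately show ?thesis using us w by (simp add: mat \<sigma>\<sigma>)
      next
        case False
        thus ?thesis using us w by (simp add: mat \<sigma>\<sigma> supp)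
      qed
      have "((\<lambda>w. y (delta u) w * T (delta w) s) has_sum T (y (delta u)) s) (carrier G)"
        using us by (intro op_expansion[OF Tb] op_ell2[OF y]) simp
      hence "((\<lambda>w. y (delta u) (?\<sigma> w) * T (delta (?\<sigma> w)) s) has_sum T (y (delta u)) s) (carrier G)"
        using has_sum_reindex_bij_betw[OF bij, of "\<lambda>w. y (delta u) w * T (delta w) s"] by simp
      hence "((\<lambda>w. T (delta u) w * y (delta w) s) has_sum T (y (delta u)) s) (carrier G)"
        using eq by (subst (asm) has_sum_cong) auto
      moreover have "((\<lambda>w. T (delta u) w * y (delta w) s) has_sum y (T (delta u)) s) (carrier G)"
        using us by (intro op_expansion[OF y] op_ell2[OF Tb]) simp
      ultimately show "(y \<circ> T) (delta u) s = (T \<circ> y) (delta u) s"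
        using has_sum_unique by fastforce
    qed
  qed
  thus ?thesis
    using y unfolding group_vNa_eq_bicommutant[OF K] by (auto simp: commutant_def)
qed

text \<open>The projection onto \<open>\<ell>\<^sup>2(K)\<close> commutes with \<open>K\<close>, hence with \<open>L(K)\<close>.\<close>

lemma group_vNa_support:
  assumes K: "subgroup K G" and x: "x \<in> group_vNa G K" and s: "s \<notin> K"
  shows "x (delta \<one>) s = 0"
proof -
  interpret K: subgroup K G by (rule K)
  define P where "P = (\<lambda>v. if v \<in> ell2 (carrier G) then restr K v else (\<lambda>_. 0))"
  have xb: "x \<in> bounded_ops (carrier G)" by (rule group_vNa_bounded[OF K x])
  have Pb: "P \<in> bounded_ops (carrier G)"
  proof (rule bounded_opsI[where C = 1])
    fix v assume v: "v \<in> ell2 (carrier G)"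
    show "P v \<in> ell2 (carrier G)"
      "ell2_norm (carrier G) (P v) \<le> 1 * ell2_norm (carrier G) v"
      using v restr_ell2[OF v] by (simp_all add: P_def)
  qed (auto simp: P_def restr_def ell2_add ell2_scale)
  have "P \<circ> left_regular G k = left_regular G k \<circ> P" if k: "k \<in> K" for k
  proof (rule op_eqI[OF comp_bounded[OF Pb left_regular_bounded] comp_bounded[OF left_regular_bounded Pb]])
    fix u t assume ut: "u \<in> carrier G" "t \<in> carrier G"
    have "inv k \<otimes> t \<in> K \<longleftrightarrow> t \<in> K"
    proof
      assume "inv k \<otimes> t \<in> K"
      hence "k \<otimes> (inv k \<otimes> t) \<in> K" using k by blast
      thus "t \<in> K" using k ut by (simp add: m_assoc[symmetric])
    qed (use k in auto)
    moreover have "inv k \<otimes> t = u \<longleftrightarrow> t = k \<otimes> u"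
      using k ut by (metis K.mem_carrier inv_closed inv_inv inv_solve_left m_closed)
    ultimately show "(P \<circ> left_regular G k) (delta u) t = (left_regular G k \<circ> P) (delta u) t"
      using k ut by (simp add: left_regular_delta)
        (simp add: P_def restr_ell2 left_regular_apply, simp add: restr_def delta_def)
  qed (use k in auto)
  hence "P \<in> commutant (carrier G) (left_regular G ` K)"
    using Pb by (auto simp: commutant_def)
  hence "x \<circ> P = P \<circ> x"
    using x by (simp add: group_vNa_eq_bicommutant[OF K] commutant_def)
  moreover have "P (delta \<one>) = delta \<one>" using delta_ell2[OF one_closed] by (auto simp: P_def restr_def delta_def)
  ultimately have "x (delta \<one>) s = P (x (delta \<one>)) s" by (metis comp_apply)
  thus ?thesis using s by (simp add: P_def restr_def)
qed

lemma group_vNa_if_support: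
  assumes K: "subgroup K G" and x: "x \<in> group_vNa G (carrier G)"
    and supp: "\<And>z. z \<in> carrier G \<Longrightarrow> z \<notin> K \<Longrightarrow> x (delta \<one>) z = 0"
  shows "x \<in> group_vNa G K"
  by (rule convolution_operator_in_group_vNa[OF K group_vNa_bounded[OF subgroup_self x]
        group_vNa_matrix[OF x] supp])

section \<open>The conditional expectation onto the algebra of a subgroup\<close>

text \<open>
  This is the block diagonal part of \<open>x\<close> for the decomposition of \<open>\<ell>\<^sup>2(G)\<close> along the right
  cosets of \<open>K\<close>, hence bounded when \<open>x\<close> is.  If \<open>x\<close> is convolution by \<open>f\<close>, the result is
  convolution by the restriction of \<open>f\<close> to \<open>K\<close>.
\<close>

definition cond_exp :: "'a set \<Rightarrow> 'a oper \<Rightarrow> 'a oper" where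
  "cond_exp K x = (\<lambda>v s. if v \<in> ell2 (carrier G) \<and> s \<in> carrier G then x (restr (K #> s) v) s else 0)"

lemma mem_r_coset_iff:
  assumes K: "subgroup K G" and "u \<in> carrier G" "s \<in> carrier G"
  shows "u \<in> K #> s \<longleftrightarrow> K #> u = K #> s" and "u \<in> K #> s \<longleftrightarrow> s \<otimes> inv u \<in> K"
proof -
  show "u \<in> K #> s \<longleftrightarrow> K #> u = K #> s"
    using assms by (metis repr_independence rcos_self)
  show "u \<in> K #> s \<longleftrightarrow> s \<otimes> inv u \<in> K"
  proof
    assume "u \<in> K #> s"
    then obtain k where k: "k \<in> K" "u = k \<otimes> s" by (auto simp: r_coset_def)
    hence "k \<in> carrier G" using K subgroup.subset by blast
    hence "s \<otimes> inv u = inv k"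
      using assms k by (simp add: inv_mult_group m_assoc[symmetric])
    thus "s \<otimes> inv u \<in> K" using k K by (simp add: subgroup.m_inv_closed)
  next
    assume *: "s \<otimes> inv u \<in> K"
    hence "inv (s \<otimes> inv u) \<in> K" using K by (simp add: subgroup.m_inv_closed)
    moreover have "u = inv (s \<otimes> inv u) \<otimes> s"
      using assms by (simp add: inv_mult_group m_assoc)
    ultimately show "u \<in> K #> s" unfolding r_coset_def by blast
  qed
qed

text \<open>
  Distinct right cosets are disjoint, so this is Bessel's inequality for the blocks.
\<close>

lemma sum_blocks_le:
  assumes K: "subgroup K G" and v: "v \<in> ell2 (carrier G)" and F: "finite F" "F \<subseteq> carrier G"
  shows "(\<Sum>D\<in>(\<lambda>s. K #> s) ` F. (ell2_norm (carrier G) (restr D v))\<^sup>2) \<le> (ell2_norm (carrier G) v)\<^sup>2"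
proof -
  let ?X = "carrier G" and ?D = "(\<lambda>s. K #> s) ` F"
  have sq: "(ell2_norm ?X w)\<^sup>2 = (\<Sum>\<^sub>\<infinity>x\<in>?X. (cmod (w x))\<^sup>2)" for w
    by (simp add: ell2_norm_def infsum_nonneg)
  have summ: "(\<lambda>x. (cmod (restr D v x))\<^sup>2) summable_on ?X" for D
    using restr_ell2(1)[OF v, of D] by (simp add: ell2_def)
  have hs: "((\<lambda>x. \<Sum>D\<in>?D. (cmod (restr D v x))\<^sup>2) has_sum
      (\<Sum>D\<in>?D. (\<Sum>\<^sub>\<infinity>x\<in>?X. (cmod (restr D v x))\<^sup>2))) ?X"
    using finite_imageI[OF F(1)]
  proof (induction rule: finite_induct)
    case (insert D \<D>)
    thus ?case using has_sum_add[OF has_sum_infsum[OF summ[of D]] insert.IH] by simp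
  qed simp
  have le: "(\<Sum>D\<in>?D. (cmod (restr D v x))\<^sup>2) \<le> (cmod (v x))\<^sup>2" if x: "x \<in> ?X" for x
  proof -
    have "(\<Sum>D\<in>?D. (cmod (restr D v x))\<^sup>2) = (\<Sum>D\<in>?D. if D = K #> x then (cmod (v x))\<^sup>2 else 0)"
    proof (rule sum.cong[OF refl])
      fix D assume "D \<in> ?D"
      then obtain s where s: "s \<in> F" "D = K #> s" by blast
      hence "x \<in> D \<longleftrightarrow> D = K #> x" using mem_r_coset_iff(1)[OF K x, of s] F by auto
      thus "(cmod (restr D v x))\<^sup>2 = (if D = K #> x then (cmod (v x))\<^sup>2 else 0)"
        by (simp add: restr_def)
    qed
    also have "\<dots> \<le> (cmod (v x))\<^sup>2" using F by simp
    finally show ?thesis .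
  qed
  show ?thesis
    unfolding sq
    by (rule has_sum_mono[OF hs has_sum_infsum le]) (use v in \<open>simp add: ell2_def\<close>)
qed

lemma cond_exp_bounded:
  assumes K: "subgroup K G" and x: "x \<in> bounded_ops (carrier G)"
  shows "cond_exp K x \<in> bounded_ops (carrier G)"
proof -
  let ?X = "carrier G"
  obtain C where C: "0 \<le> C" "\<And>v. v \<in> ell2 ?X \<Longrightarrow> ell2_norm ?X (x v) \<le> C * ell2_norm ?X v"
    using op_bound[OF x] by blast
  have bd: "L2_set (\<lambda>s. cmod (cond_exp K x v s)) F \<le> C * ell2_norm ?X v"
    if v: "v \<in> ell2 ?X" and F: "finite F" "F \<subseteq> ?X" for v F
  proof -
    let ?f = "\<lambda>s. (cmod (cond_exp K x v s))\<^sup>2"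
    have block: "sum ?f {s \<in> F. K #> s = D} \<le> C\<^sup>2 * (ell2_norm ?X (restr D v))\<^sup>2" for D
    proof -
      let ?F = "{s \<in> F. K #> s = D}"
      have "sum ?f ?F = (\<Sum>s\<in>?F. (cmod (x (restr D v) s))\<^sup>2)"
        using v F by (intro sum.cong) (auto simp: cond_exp_def)
      also have "\<dots> = (L2_set (\<lambda>s. cmod (x (restr D v) s)) ?F)\<^sup>2"
        by (simp add: L2_set_def sum_nonneg)
      also have "\<dots> \<le> (C * ell2_norm ?X (restr D v))\<^sup>2"
      proof (rule power_mono)
        have "L2_set (\<lambda>s. cmod (x (restr D v) s)) ?F \<le> ell2_norm ?X (x (restr D v))"
          using F by (intro L2_set_le_ell2_norm op_ell2[OF x] restr_ell2 v) auto
        also have "\<dots> \<le> C * ell2_norm ?X (restr D v)" by (rule C(2)[OF restr_ell2(1)[OF v]])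
        finally show "L2_set (\<lambda>s. cmod (x (restr D v) s)) ?F \<le> C * ell2_norm ?X (restr D v)" .
      qed simp
      finally show ?thesis by (simp add: power_mult_distrib)
    qed
    have "sum ?f F = (\<Sum>D\<in>(\<lambda>s. K #> s) ` F. sum ?f {s \<in> F. K #> s = D})"
      by (rule sum.image_gen[OF F(1)])
    also have "\<dots> \<le> (\<Sum>D\<in>(\<lambda>s. K #> s) ` F. C\<^sup>2 * (ell2_norm ?X (restr D v))\<^sup>2)"
      by (rule sum_mono) (rule block)
    also have "\<dots> \<le> C\<^sup>2 * (ell2_norm ?X v)\<^sup>2"
      using sum_blocks_le[OF K v F] by (simp add: sum_distrib_left[symmetric] mult_left_mono)
    finally have "L2_set (\<lambda>s. cmod (cond_exp K x v s)) F \<le> sqrt ((C * ell2_norm ?X v)\<^sup>2)"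
      unfolding L2_set_def by (intro real_sqrt_le_mono) (simp add: power_mult_distrib)
    thus ?thesis using C(1) by simp
  qed
  have restr_add: "restr D (\<lambda>x. v x + w x) = (\<lambda>x. restr D v x + restr D w x)" for D and v w :: "'a vec"
    by (auto simp: restr_def)
  have restr_scale: "restr D (\<lambda>x. c * v x) = (\<lambda>x. c * restr D v x)" for D c and v :: "'a vec"
    by (auto simp: restr_def)
  show ?thesis
  proof (rule bounded_opsI)
    fix v assume v: "v \<in> ell2 ?X"
    show "cond_exp K x v \<in> ell2 ?X" "ell2_norm ?X (cond_exp K x v) \<le> C * ell2_norm ?X v"
      using ell2_if_L2_set_le[OF _ _ bd[OF v]] C(1) by (auto simp: cond_exp_def)
  qed (auto simp: cond_exp_def ell2_add ell2_scale restr_add restr_scale op_add[OF x] op_scale[OF x]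
      restr_ell2)
qed

lemma cond_exp_matrix:
  assumes K: "subgroup K G" and x: "x \<in> group_vNa G (carrier G)"
    and us: "u \<in> carrier G" "s \<in> carrier G"
  shows "cond_exp K x (delta u) s = (if s \<otimes> inv u \<in> K then x (delta \<one>) (s \<otimes> inv u) else 0)"
proof -
  have "restr (K #> s) (delta u) = (if s \<otimes> inv u \<in> K then delta u else (\<lambda>_. 0))"
    using mem_r_coset_iff(2)[OF K us] by (auto simp: restr_def delta_def)
  thus ?thesis
    using us group_vNa_matrix[OF x us] op_zero[OF group_vNa_bounded[OF subgroup_self x]]
    by (simp add: cond_exp_def)
qed

lemma cond_exp_in_group_vNa:
  assumes K: "subgroup K G" and x: "x \<in> group_vNa G (carrier G)"
  shows "cond_exp K x \<in> group_vNa G K"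
  by (rule convolution_operator_in_group_vNa[OF K cond_exp_bounded[OF K group_vNa_bounded[OF subgroup_self x]],
        where \<phi> = "\<lambda>z. if z \<in> K then x (delta \<one>) z else 0"])
    (simp_all add: cond_exp_matrix[OF K x])

section \<open>Geometric series of group elements\<close>

lemma geometric_series_summable:
  fixes z :: "nat \<Rightarrow> complex"
  assumes r: "0 \<le> r" "r < 1" and z: "\<And>k. cmod (z k) \<le> N"
  shows "summable (\<lambda>k. of_real (r ^ k) * z k)"
proof (rule summable_comparison_test'[where N = 0])
  show "summable (\<lambda>k. r ^ k * N)"
    using r by (intro summable_mult2 summable_geometric) simp
  show "norm (of_real (r ^ n) * z n) \<le> r ^ n * N" for n
    using r z[of n] by (simp add: norm_mult norm_power mult_left_mono)
qed

text \<open>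
  The norm-convergent series \<open>\<Sum>\<^sub>k r\<^sup>k \<lambda>(h\<^sub>k)\<close>.  It packs a whole sequence of
  group elements into one element of \<open>L(H)\<close>.
\<close>

definition weighted_translates :: "real \<Rightarrow> (nat \<Rightarrow> 'a) \<Rightarrow> 'a oper" where
  "weighted_translates r h = (\<lambda>v s. if v \<in> ell2 (carrier G) \<and> s \<in> carrier G
     then \<Sum>k. of_real (r ^ k) * v (inv (h k) \<otimes> s) else 0)"

lemma weighted_translates_bounded:
  assumes r: "0 \<le> r" "r < 1" and h: "\<And>k. h k \<in> carrier G"
  shows "weighted_translates r h \<in> bounded_ops (carrier G)"
proof -
  let ?X = "carrier G" and ?b = "weighted_translates r h"
  have summ: "summable (\<lambda>k. of_real (r ^ k) * v (inv (h k) \<otimes> s))" if "v \<in> ell2 ?X" for v s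
    by (rule geometric_series_summable[OF r]) (rule cmod_le_ell2_norm[OF that])
  have bd: "L2_set (\<lambda>s. cmod (?b v s)) F \<le> (1 / (1 - r)) * ell2_norm ?X v"
    if v: "v \<in> ell2 ?X" and F: "finite F" "F \<subseteq> ?X" for v F
  proof -
    define p where "p = (\<lambda>n s. \<Sum>k<n. of_real (r ^ k) * left_regular G (h k) v s)"
    have p: "p n \<in> ell2 ?X \<and> ell2_norm ?X (p n) \<le> (\<Sum>k<n. r ^ k) * ell2_norm ?X v" for n
    proof (induction n)
      case (Suc n)
      let ?t = "\<lambda>s. of_real (r ^ n) * left_regular G (h n) v s"
      have t: "?t \<in> ell2 ?X" by (rule ell2_scale(1)[OF left_regular_ell2(1)[OF h v]])
      have "ell2_norm ?X ?t \<le> cmod (of_real (r ^ n)) * ell2_norm ?X (left_regular G (h n) v)"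
        by (rule ell2_scale(2)[OF left_regular_ell2(1)[OF h v]])
      also have "\<dots> \<le> r ^ n * ell2_norm ?X v"
        using r left_regular_ell2(2)[OF h v] by (simp add: norm_power mult_left_mono)
      finally have "ell2_norm ?X ?t \<le> r ^ n * ell2_norm ?X v" .
      moreover have "p (Suc n) = (\<lambda>s. p n s + ?t s)" by (simp add: p_def)
      ultimately show ?case
        using Suc ell2_add[OF conjunct1[OF Suc] t] by (simp add: distrib_right)
    qed (simp add: p_def)
    have "L2_set (\<lambda>s. cmod (p n s)) F \<le> (1 / (1 - r)) * ell2_norm ?X v" for n
    proof -
      have "L2_set (\<lambda>s. cmod (p n s)) F \<le> (\<Sum>k<n. r ^ k) * ell2_norm ?X v"
        using p[of n] L2_set_le_ell2_norm[of "p n" ?X F] F by simp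
      also have "(\<Sum>k<n. r ^ k) \<le> (\<Sum>k. r ^ k)"
        using r by (intro sum_le_suminf summable_geometric) auto
      also have "(\<Sum>k. r ^ k) = 1 / (1 - r)" using r by (intro suminf_geometric) simp
      finally show ?thesis by (simp add: mult_right_mono)
    qed
    moreover have "(\<lambda>n. L2_set (\<lambda>s. cmod (p n s)) F) \<longlonglongrightarrow> L2_set (\<lambda>s. cmod (?b v s)) F"
      unfolding L2_set_def
    proof (intro tendsto_real_sqrt tendsto_sum tendsto_power tendsto_norm)
      fix s assume "s \<in> F"
      hence s: "s \<in> ?X" using F by auto
      show "(\<lambda>n. p n s) \<longlonglongrightarrow> ?b v s"
        using summable_LIMSEQ[OF summ[OF v, of s]] v s
        by (simp add: p_def weighted_translates_def left_regular_apply)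
    qed
    ultimately show ?thesis by (intro LIMSEQ_le_const2) auto
  qed
  show ?thesis
  proof (rule bounded_opsI)
    fix v assume v: "v \<in> ell2 ?X"
    have "0 \<le> (1 / (1 - r)) * ell2_norm ?X v" using r by simp
    thus "?b v \<in> ell2 ?X" "ell2_norm ?X (?b v) \<le> (1 / (1 - r)) * ell2_norm ?X v"
      using ell2_if_L2_set_le[OF _ _ bd[OF v]] by (auto simp: weighted_translates_def)
  next
    fix v w assume "v \<in> ell2 ?X" "w \<in> ell2 ?X"
    thus "?b (\<lambda>x. v x + w x) = (\<lambda>x. ?b v x + ?b w x)"
      using summ by (auto simp: weighted_translates_def ell2_add distrib_left suminf_add)
  next
    fix c v assume v: "v \<in> ell2 ?X"
    show "?b (\<lambda>x. c * v x) = (\<lambda>x. c * ?b v x)"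
    proof
      fix s
      show "?b (\<lambda>x. c * v x) s = c * ?b v s"
        using v suminf_mult[OF summ[OF v], of c s]
        by (simp add: weighted_translates_def ell2_scale mult.left_commute)
    qed
  qed (auto simp: weighted_translates_def)
qed

lemma weighted_translates_in_group_vNa:
  assumes H: "subgroup H G" and r: "0 \<le> r" "r < 1" and h: "\<And>k. h k \<in> H"
  shows "weighted_translates r h \<in> group_vNa G H"
proof (rule convolution_operator_in_group_vNa[OF H,
      where \<phi> = "\<lambda>z. \<Sum>k. of_real (r ^ k) * delta \<one> (inv (h k) \<otimes> z)"])
  have hG: "h k \<in> carrier G" for k using h H subgroup.subset by blast
  show "weighted_translates r h \<in> bounded_ops (carrier G)"
    by (rule weighted_translates_bounded[OF r hG])
  show "weighted_translates r h (delta u) s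
      = (\<Sum>k. of_real (r ^ k) * delta \<one> (inv (h k) \<otimes> (s \<otimes> inv u)))"
    if us: "u \<in> carrier G" "s \<in> carrier G" for u s
  proof -
    have "delta u (inv (h k) \<otimes> s) = delta \<one> (inv (h k) \<otimes> (s \<otimes> inv u))" for k
    proof -
      have "inv (h k) \<otimes> s = u \<longleftrightarrow> inv (h k) \<otimes> s \<otimes> inv u = \<one>"
        using us hG[of k] by (metis inv_closed inv_solve_right l_one m_closed one_closed)
      thus ?thesis using us hG[of k] by (simp add: delta_def m_assoc)
    qed
    thus ?thesis using us by (simp add: weighted_translates_def)
  qed
  show "(\<Sum>k. of_real (r ^ k) * delta \<one> (inv (h k) \<otimes> z)) = 0"
    if z: "z \<in> carrier G" "z \<notin> H" for z
  proof -
    have "inv (h k) \<otimes> z \<noteq> \<one>" for k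
    proof
      assume "inv (h k) \<otimes> z = \<one>"
      hence "z = h k" using z hG[of k] by (metis inv_closed inv_equality inv_inv l_inv inv_comm)
      thus False using z h by simp
    qed
    thus ?thesis by (simp add: delta_def)
  qed
qed

text \<open>
  The \<open>m\<close>-th term dominates: the later terms are small because \<open>r\<close> is small, the earlier ones
  by the last hypothesis.  Either group amounts to at most a quarter of \<open>r\<^sup>m a\<close>.
\<close>

lemma geometric_series_lower_bound:
  fixes z :: "nat \<Rightarrow> complex"
  assumes r: "0 \<le> r" "r \<le> 1/8" and a: "a = cmod (z m)"
    and z: "\<And>k. cmod (z k) \<le> N" and rN: "r * N \<le> a / 8"
    and early: "\<And>k. k < m \<Longrightarrow> cmod (z k) \<le> r ^ m * (a / 8)"
  shows "r ^ m * (a / 2) \<le> cmod (\<Sum>k. of_real (r ^ k) * z k)"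
proof -
  have r1: "r < 1" using r by simp
  have a0: "0 \<le> a" by (simp add: a)
  define t where "t = (\<lambda>k. of_real (r ^ k) * z k)"
  have summ: "summable t"
    unfolding t_def by (rule geometric_series_summable[OF r(1) r1 z])
  have gs: "summable (\<lambda>k. r ^ k)" "(\<Sum>k. r ^ k) = 1 / (1 - r)"
    using r r1 by (auto intro: summable_geometric suminf_geometric)
  have gs2: "1 / (1 - r) \<le> 2" using r by (simp add: field_simps)
  have A: "cmod (\<Sum>k<m. t k) \<le> r ^ m * (a / 4)"
  proof -
    have "cmod (\<Sum>k<m. t k) \<le> (\<Sum>k<m. r ^ k * (r ^ m * (a / 8)))"
    proof (rule sum_norm_le)
      fix k assume "k \<in> {..<m}"
      hence "cmod (z k) \<le> r ^ m * (a / 8)" by (intro early) simp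
      thus "cmod (t k) \<le> r ^ k * (r ^ m * (a / 8))"
        using r by (simp only: t_def norm_mult norm_of_real abs_of_nonneg zero_le_power mult_left_mono)
    qed
    also have "\<dots> = (\<Sum>k<m. r ^ k) * (r ^ m * (a / 8))" by (simp add: sum_distrib_right)
    also have "\<dots> \<le> 2 * (r ^ m * (a / 8))"
    proof (rule mult_right_mono)
      have "(\<Sum>k<m. r ^ k) \<le> (\<Sum>k. r ^ k)" using r gs by (intro sum_le_suminf) auto
      thus "(\<Sum>k<m. r ^ k) \<le> 2" using gs gs2 by simp
    qed (use r a0 in simp)
    finally show ?thesis by (simp add: mult.commute)
  qed
  have B: "cmod (\<Sum>k. t (k + Suc m)) \<le> r ^ m * (a / 4)"
  proof -
    have N0: "0 \<le> N" using z[of 0] norm_ge_zero[of "z 0"] by linarith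
    have s2: "summable (\<lambda>k. r ^ k * (r ^ Suc m * N))" by (rule summable_mult2[OF gs(1)])
    have "cmod (\<Sum>k. t (k + Suc m)) \<le> (\<Sum>k. r ^ k * (r ^ Suc m * N))"
    proof (rule norm_suminf_le[OF _ s2])
      fix k
      show "cmod (t (k + Suc m)) \<le> r ^ k * (r ^ Suc m * N)"
        using r z[of "k + Suc m"] mult_left_mono[OF z, of "r ^ (k + Suc m)" "k + Suc m"]
        by (simp add: t_def norm_mult norm_power power_add mult_ac)
    qed
    also have "\<dots> = (1 / (1 - r)) * (r ^ Suc m * N)" using suminf_mult2[OF gs(1)] gs(2) by metis
    also have "\<dots> \<le> 2 * (r ^ Suc m * N)" using r N0 gs2 by (intro mult_right_mono) auto
    also have "\<dots> = 2 * r ^ m * (r * N)" by simp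
    also have "\<dots> \<le> 2 * r ^ m * (a / 8)" using r by (intro mult_left_mono rN) auto
    finally show ?thesis by (simp add: mult.commute)
  qed
  have "suminf t = (\<Sum>k. t (k + Suc m)) + ((\<Sum>k<m. t k) + t m)"
    using suminf_split_initial_segment[OF summ, of "Suc m"] by simp
  hence tm: "t m = suminf t - (\<Sum>k. t (k + Suc m)) - (\<Sum>k<m. t k)" by simp
  have "cmod (t m) \<le> cmod (suminf t) + cmod (\<Sum>k. t (k + Suc m)) + cmod (\<Sum>k<m. t k)"
    unfolding tm
    using norm_triangle_ineq4[of "suminf t - (\<Sum>k. t (k + Suc m))" "\<Sum>k<m. t k"]
      norm_triangle_ineq4[of "suminf t" "\<Sum>k. t (k + Suc m)"] by linarith
  moreover have "cmod (t m) = r ^ m * a" using r by (simp add: t_def a norm_mult norm_power)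
  ultimately have "r ^ m * (a / 2) \<le> cmod (suminf t)"
    using A B by (simp add: mult.commute)
  thus ?thesis by (simp add: t_def)
qed

section \<open>One sided quasi-normalizers are supported in the semigroup\<close>

text \<open>
  Convolving with a function on \<open>H\<close> from the right moves mass only inside left cosets of \<open>H\<close>.
  Hence the value at \<open>t\<close> sees of \<open>y \<delta>\<^sub>1\<close> only its part on \<open>tH\<close>, which is small for all but
  finitely many cosets, and of the other factor only its 2-norm; no control of its operator
  norm is involved.
\<close>

lemma coset_estimate:
  assumes H: "subgroup H G" and y: "y \<in> group_vNa G (carrier G)"
    and w: "w \<in> ell2 (carrier G)" "\<And>u. u \<notin> H \<Longrightarrow> w u = 0" and t: "t \<in> carrier G"
  shows "cmod (y w t) \<le> ell2_norm (carrier G) w * ell2_norm (carrier G) (restr (t <#\<^bsub>G\<^esub> H) (y (delta \<one>)))"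
proof -
  let ?X = "carrier G"
  have yb: "y \<in> bounded_ops ?X" by (rule group_vNa_bounded[OF subgroup_self y])
  define v where "v = restr (t <#\<^bsub>G\<^esub> H) (y (delta \<one>))"
  have v: "v \<in> ell2 ?X" unfolding v_def by (intro restr_ell2 op_ell2[OF yb]) simp
  define q where "q = (\<lambda>u. if u \<in> ?X then v (t \<otimes> inv u) else 0)"
  have "inj_on (\<lambda>u. t \<otimes> inv u) ?X" "(\<lambda>u. t \<otimes> inv u) ` ?X \<subseteq> ?X"
    using t by (auto simp: inj_on_def inj_on_eq_iff[OF inv_inj])
  from ell2_reindex[OF this v]
  have q: "q \<in> ell2 ?X" "ell2_norm ?X q \<le> ell2_norm ?X v" by (simp_all add: q_def)
  have cq: "(\<lambda>u. cnj (q u)) \<in> ell2 ?X" "ell2_norm ?X (\<lambda>u. cnj (q u)) \<le> ell2_norm ?X q"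
    using ell2_mono[OF q(1), of "\<lambda>u. cnj (q u)"] by auto
  have "((\<lambda>u. w u * y (delta u) t) has_sum y w t) ?X" by (rule op_expansion[OF yb w(1)])
  moreover have "w u * y (delta u) t = w u * cnj (cnj (q u))" if u: "u \<in> ?X" for u
  proof (cases "u \<in> H")
    case True
    hence "t \<otimes> inv u \<in> t <#\<^bsub>G\<^esub> H"
      using subgroup.m_inv_closed[OF H] by (auto simp: l_coset_def)
    thus ?thesis using u t by (simp add: q_def v_def restr_def group_vNa_matrix[OF y u t])
  qed (simp add: w(2))
  ultimately have "((\<lambda>u. w u * cnj (cnj (q u))) has_sum y w t) ?X"
    by (subst (asm) has_sum_cong) auto
  hence "y w t = ell2_inner ?X w (\<lambda>u. cnj (q u))"
    using inner_has_sum[OF w(1) cq(1)] has_sum_unique by blast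
  hence "cmod (y w t) \<le> ell2_norm ?X w * ell2_norm ?X (\<lambda>u. cnj (q u))"
    using inner_Cauchy_Schwarz[OF w(1) cq(1)] by simp
  also have "\<dots> \<le> ell2_norm ?X w * ell2_norm ?X v"
    using q cq by (intro mult_left_mono) auto
  finally show ?thesis by (simp add: v_def)
qed

lemma ell2_tail_finite_family:
  assumes W: "finite W" "W \<subseteq> ell2 X" and e: "0 < (e::real)"
  shows "\<exists>E. finite E \<and> E \<subseteq> X \<and> (\<forall>w\<in>W. \<forall>A. A \<inter> E = {} \<longrightarrow> ell2_norm X (restr A w) < e)"
  using W
proof (induction W rule: finite_induct)
  case (insert v W)
  then obtain E where E: "finite E" "E \<subseteq> X"
    "\<forall>w\<in>W. \<forall>A. A \<inter> E = {} \<longrightarrow> ell2_norm X (restr A w) < e" by auto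
  obtain E' where E': "finite E'" "E' \<subseteq> X" "\<And>A. A \<inter> E' = {} \<Longrightarrow> ell2_norm X (restr A v) < e"
    using ell2_tail[of v X e] insert.prems e by auto
  have "\<forall>w\<in>insert v W. \<forall>A. A \<inter> (E \<union> E') = {} \<longrightarrow> ell2_norm X (restr A w) < e"
    using E(3) E'(3) by (auto simp: Int_Un_distrib)
  thus ?case using E E' by (intro exI[of _ "E \<union> E'"]) auto
qed auto

text \<open>
  If \<open>g\<close> is not a one sided quasi-normalizer, then \<open>HgH\<close> consists of infinitely many left
  cosets of \<open>H\<close>, so the orbit \<open>Hg\<close> leaves every finite union of them.
\<close>

lemma escape_finite_cosets:
  assumes g: "g \<in> carrier G" "g \<notin> group_qn1 G H" and E: "finite E" "E \<subseteq> carrier G"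
  shows "\<exists>h\<in>H. \<forall>e\<in>E. h \<otimes> g \<notin> e <#\<^bsub>G\<^esub> H"
proof (rule ccontr)
  assume "\<not> ?thesis"
  hence "H #> g \<subseteq> (\<Union>e\<in>E. e <#\<^bsub>G\<^esub> H)" by (auto simp: r_coset_def)
  with g(1) E have "g \<in> group_qn1 G H" unfolding group_qn1_def by (intro CollectI conjI exI[of _ E])
  with g(2) show False by contradiction
qed

text \<open>
  Suppose \<open>f = x \<delta>\<^sub>1\<close> does not vanish at some \<open>g\<close> outside the semigroup, and let \<open>F\<close> be the finite
  set with \<open>L(H) x \<subseteq> \<Sum>\<^sub>y y L(H)\<close>.  The coefficients in this sum depend on the element of
  \<open>L(H)\<close> without any uniform bound, so translating \<open>x\<close> by single group elements gives no
  contradiction by itself.  Instead one element \<open>b = \<Sum>\<^sub>k r\<^sup>k h\<^sub>k\<close> is tested, for which the coefficients are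
  fixed once and for all.  The \<open>h\<^sub>m\<close> are chosen recursively such that \<open>h\<^sub>m g\<close> lies in a left
  coset on which all \<open>y \<delta>\<^sub>1\<close> have norm at most a constant times \<open>r\<^sup>2\<^sup>m\<close>, and such that the earlier
  translates \<open>h\<^sub>k f\<close> are small at \<open>h\<^sub>m g\<close>.  Then \<open>(b f)(h\<^sub>m g)\<close> is of order \<open>r\<^sup>m\<close> when computed
  from the series and of order \<open>r\<^sup>2\<^sup>m\<close> when computed from the finite sum.
\<close>

lemma vN_qn1_support:
  assumes H: "subgroup H G" and x: "x \<in> vN_qn1 (group_vNa G (carrier G)) (group_vNa G H)"
    and g: "g \<in> carrier G" and nz: "x (delta \<one>) g \<noteq> 0"
  shows "g \<in> group_qn1 G H"
proof (rule ccontr)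
  assume gn: "g \<notin> group_qn1 G H"
  let ?X = "carrier G" and ?M = "group_vNa G (carrier G)"
  interpret H: subgroup H G by (rule H)
  obtain F where xM: "x \<in> ?M" and F: "finite F" "F \<subseteq> ?M"
    and xF: "(\<lambda>b. b \<circ> x) ` group_vNa G H \<subseteq> sum_right_mult F (group_vNa G H)"
    using x by (auto simp: vN_qn1_def)
  have bdd: "y \<in> bounded_ops ?X" if "y \<in> ?M" for y by (rule group_vNa_bounded[OF subgroup_self that])
  define f where "f = x (delta \<one>)"
  have f: "f \<in> ell2 ?X" unfolding f_def by (intro op_ell2[OF bdd[OF xM]]) simp
  define N where "N = ell2_norm ?X f"
  define a where "a = cmod (f g)"
  have a: "0 < a" using nz by (simp add: a_def f_def)
  have aN: "a \<le> N" unfolding a_def N_def by (rule cmod_le_ell2_norm[OF f])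
  \<comment> \<open>The ratio makes the tail of the series after the \<open>m\<close>-th term at most a quarter of that term.\<close>
  define r where "r = a / (8 * N)"
  have r: "0 < r" "r \<le> 1/8" "r * N \<le> a / 8"
    using a aN by (auto simp: r_def field_simps)
  \<comment> \<open>The factor \<open>r\<^sup>2\<^sup>m\<close> beats the size \<open>r\<^sup>m\<close> of the \<open>m\<close>-th term, whatever the coefficients are.\<close>
  define e where "e = (\<lambda>m. r ^ m * (r ^ m * (a / 8)))"
  have e: "0 < e m" for m using r a by (simp add: e_def)
  define W where "W = insert f ((\<lambda>y. y (delta \<one>)) ` F)"
  have W: "finite W" "W \<subseteq> ell2 ?X"
    using F f op_ell2[OF bdd delta_ell2[OF one_closed]] by (auto simp: W_def)
  have "\<exists>E. \<forall>m. finite (E m) \<and> E m \<subseteq> ?X \<and>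
      (\<forall>w\<in>W. \<forall>A. A \<inter> E m = {} \<longrightarrow> ell2_norm ?X (restr A w) < e m)"
    by (rule choice) (use ell2_tail_finite_family[OF W e] in blast)
  then obtain E where E: "\<And>m. finite (E m)" "\<And>m. E m \<subseteq> ?X"
    and tail: "\<And>m w A. w \<in> W \<Longrightarrow> A \<inter> E m = {} \<Longrightarrow> ell2_norm ?X (restr A w) < e m"
    by metis
  \<comment> \<open>Off \<open>E m\<close>, the functions in \<open>W\<close> have norm below \<open>e m\<close>.  The sets \<open>E m\<close> keep the coset of \<open>h m \<otimes> g\<close> away from
    the mass of the \<open>y \<delta>\<^sub>1\<close>, the translates \<open>h j \<otimes> E m\<close> keep \<open>h m \<otimes> g\<close> away from that of the earlier
    translates of \<open>f\<close>.  The case distinction keeps the avoided set inside \<open>G\<close> for arbitrary \<open>h\<close>.\<close>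
  define P where "P = (\<lambda>h m k. k \<in> H \<and>
    (\<forall>t \<in> E m \<union> (\<Union>j<m. if h j \<in> H then (\<lambda>t. h j \<otimes> t) ` E m else {}). k \<otimes> g \<notin> t <#\<^bsub>G\<^esub> H))"
  have "\<exists>h. \<forall>m. P h m (h m)"
  proof (rule dependent_wellorder_choice)
    fix k m and h h' :: "nat \<Rightarrow> 'a"
    assume "\<And>j. j < m \<Longrightarrow> h j = h' j"
    thus "P h m k = P h' m k" unfolding P_def by (intro arg_cong2[where f = conj] refl ball_cong) auto
  next
    fix m and h :: "nat \<Rightarrow> 'a"
    show "\<exists>k. P h m k"
    proof -
      have "\<exists>k\<in>H. \<forall>t \<in> E m \<union> (\<Union>j<m. if h j \<in> H then (\<lambda>t. h j \<otimes> t) ` E m else {}). k \<otimes> g \<notin> t <#\<^bsub>G\<^esub> H"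
        by (rule escape_finite_cosets[OF g gn])
          (use E in \<open>auto split: if_splits intro!: m_closed\<close>)
      thus ?thesis by (auto simp: P_def)
    qed
  qed
  then obtain h where Ph: "\<And>m. P h m (h m)" by blast
  have h: "h m \<in> H" for m using Ph[of m] by (simp add: P_def)
  have hG: "h m \<in> ?X" for m using h by simp
  have new: "h m \<otimes> g \<notin> t <#\<^bsub>G\<^esub> H" if "t \<in> E m" for m t
    using Ph[of m] that by (auto simp: P_def)
  have new': "h m \<otimes> g \<notin> (h k \<otimes> t) <#\<^bsub>G\<^esub> H" if "k < m" "t \<in> E m" for k m t
    using Ph[of m] that h[of k] by (auto simp: P_def)
  define b where "b = weighted_translates r h"
  have bH: "b \<in> group_vNa G H"
    unfolding b_def using r by (intro weighted_translates_in_group_vNa[OF H _ _ h]) auto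
  have "b \<circ> x \<in> sum_right_mult F (group_vNa G H)" using xF bH by blast
  then obtain c where c: "\<And>y. y \<in> F \<Longrightarrow> c y \<in> group_vNa G H"
    and bx: "b \<circ> x = (\<lambda>\<xi> v. \<Sum>y\<in>F. (y \<circ> c y) \<xi> v)"
    by (auto simp: sum_right_mult_def)
  define S where "S = (\<Sum>y\<in>F. ell2_norm ?X (c y (delta \<one>)))"
  have upper: "cmod (b f (h m \<otimes> g)) \<le> S * e m" for m
  proof -
    let ?t = "h m \<otimes> g"
    have t: "?t \<in> ?X" using hG g by simp
    have disj: "(?t <#\<^bsub>G\<^esub> H) \<inter> E m = {}"
    proof -
      have "s \<notin> E m" if s: "s \<in> ?t <#\<^bsub>G\<^esub> H" for s
      proof
        assume sE: "s \<in> E m"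
        have "?t \<in> s <#\<^bsub>G\<^esub> H"
          by (rule l_coset_swap[OF s t H])
        thus False using new[OF sE] by simp
      qed
      thus ?thesis by blast
    qed
    have "cmod (b f ?t) = cmod (\<Sum>y\<in>F. y (c y (delta \<one>)) ?t)"
      using fun_cong[OF fun_cong[OF bx, of "delta \<one>"], of ?t] by (simp add: f_def)
    also have "\<dots> \<le> (\<Sum>y\<in>F. ell2_norm ?X (c y (delta \<one>)) * e m)"
    proof (rule sum_norm_le)
      fix y assume y: "y \<in> F"
      let ?w = "c y (delta \<one>)"
      have w: "?w \<in> ell2 ?X" by (intro op_ell2[OF group_vNa_bounded[OF H c[OF y]]]) simp
      have "cmod (y ?w ?t) \<le> ell2_norm ?X ?w * ell2_norm ?X (restr (?t <#\<^bsub>G\<^esub> H) (y (delta \<one>)))"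
        by (rule coset_estimate[OF H _ w group_vNa_support[OF H c[OF y]] t]) (use F y in auto)
      also have "\<dots> \<le> ell2_norm ?X ?w * e m"
        using tail[OF _ disj, of "y (delta \<one>)"] y by (intro mult_left_mono) (auto simp: W_def)
      finally show "cmod (y ?w ?t) \<le> ell2_norm ?X ?w * e m" .
    qed
    finally show ?thesis by (simp add: S_def sum_distrib_right)
  qed
  have lower: "r ^ m * (a / 2) \<le> cmod (b f (h m \<otimes> g))" for m
  proof -
    define z where "z = (\<lambda>k. f (inv (h k) \<otimes> (h m \<otimes> g)))"
    have "b f (h m \<otimes> g) = (\<Sum>k. of_real (r ^ k) * z k)"
      using f hG g by (simp add: b_def weighted_translates_def z_def)
    moreover have "r ^ m * (a / 2) \<le> cmod (\<Sum>k. of_real (r ^ k) * z k)"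
    proof (rule geometric_series_lower_bound[where N = N])
      show "0 \<le> r" "r \<le> 1/8" "r * N \<le> a / 8" using r by auto
      show "a = cmod (z m)"
        using hG[of m] g by (simp add: z_def a_def m_assoc[symmetric])
      show "cmod (z k) \<le> N" for k unfolding z_def N_def by (rule cmod_le_ell2_norm[OF f])
      fix k assume k: "k < m"
      let ?s = "inv (h k) \<otimes> (h m \<otimes> g)"
      have s: "?s \<in> ?X" using hG g by simp
      have hs: "h k \<otimes> ?s = h m \<otimes> g" using hG[of k] hG[of m] g by (simp add: m_assoc[symmetric])
      have "?s \<notin> E m"
      proof
        assume "?s \<in> E m"
        from new'[OF k this] have "h m \<otimes> g \<notin> (h m \<otimes> g) <#\<^bsub>G\<^esub> H" by (simp only: hs not_False_eq_True)
        moreover have "(h m \<otimes> g) \<otimes> \<one> \<in> (h m \<otimes> g) <#\<^bsub>G\<^esub> H" unfolding l_coset_def using H.one_closed by blast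
        ultimately show False using hG g by simp
      qed
      hence *: "ell2_norm ?X (restr {?s} f) < e m"
        by (intro tail) (auto simp: W_def)
      have "cmod (z k) = cmod (restr {?s} f ?s)" by (simp add: z_def restr_def)
      also have "\<dots> \<le> ell2_norm ?X (restr {?s} f)" by (rule cmod_le_ell2_norm[OF restr_ell2(1)[OF f]])
      also have "\<dots> \<le> e m" using * by simp
      also have "\<dots> \<le> 1 * (r ^ m * (a / 8))"
        unfolding e_def using r a by (intro mult_right_mono power_le_one) auto
      finally show "cmod (z k) \<le> r ^ m * (a / 8)" by simp
    qed
    ultimately show ?thesis by simp
  qed
  have "4 \<le> S * r ^ m" for m
  proof -
    have "(r ^ m * (a / 8)) * 4 \<le> (r ^ m * (a / 8)) * (S * r ^ m)"
      using order_trans[OF lower[of m] upper[of m]] by (simp add: e_def mult_ac)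
    moreover have "0 < r ^ m * (a / 8)" using r a by simp
    ultimately show ?thesis by (simp only: mult_le_cancel_left_pos)
  qed
  moreover have "(\<lambda>m. S * r ^ m) \<longlonglongrightarrow> S * 0"
    using r by (intro tendsto_mult_left LIMSEQ_realpow_zero) auto
  ultimately have "4 \<le> S * 0" by (intro LIMSEQ_le_const) auto
  thus False by simp
qed

section \<open>The semigroup of one sided quasi-normalizers\<close>

lemma group_qn1_subset: "group_qn1 G H \<subseteq> carrier G"
  by (auto simp: group_qn1_def)

lemma one_in_group_qn1:
  assumes H: "subgroup H G" shows "\<one> \<in> group_qn1 G H"
proof -
  have "H #> \<one> \<subseteq> (\<Union>x\<in>{\<one>}. x <#\<^bsub>G\<^esub> H)"
    using subgroup.mem_carrier[OF H] by (auto simp: r_coset_def l_coset_def)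
  thus ?thesis unfolding group_qn1_def by (intro CollectI conjI exI[of _ "{\<one>}"]) auto
qed

lemma group_qn1_mult:
  assumes H: "subgroup H G" and g: "g \<in> group_qn1 G H" and k: "k \<in> group_qn1 G H"
  shows "g \<otimes> k \<in> group_qn1 G H"
proof -
  interpret H: subgroup H G by (rule H)
  obtain A where A: "finite A" "A \<subseteq> carrier G" "H #> g \<subseteq> (\<Union>x\<in>A. x <#\<^bsub>G\<^esub> H)" and gG: "g \<in> carrier G"
    using g by (auto simp: group_qn1_def)
  obtain B where B: "finite B" "B \<subseteq> carrier G" "H #> k \<subseteq> (\<Union>x\<in>B. x <#\<^bsub>G\<^esub> H)" and kG: "k \<in> carrier G"
    using k by (auto simp: group_qn1_def)
  let ?C = "(\<lambda>(x, y). x \<otimes> y) ` (A \<times> B)"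
  have "h \<otimes> (g \<otimes> k) \<in> (\<Union>z\<in>?C. z <#\<^bsub>G\<^esub> H)" if h: "h \<in> H" for h
  proof -
    have "h \<otimes> g \<in> (\<Union>x\<in>A. x <#\<^bsub>G\<^esub> H)" using A(3) h by (auto simp: r_coset_def)
    then obtain x h' where x: "x \<in> A" "h' \<in> H" "h \<otimes> g = x \<otimes> h'" by (auto simp: l_coset_def)
    have "h' \<otimes> k \<in> (\<Union>x\<in>B. x <#\<^bsub>G\<^esub> H)" using B(3) x(2) by (auto simp: r_coset_def)
    then obtain y h'' where y: "y \<in> B" "h'' \<in> H" "h' \<otimes> k = y \<otimes> h''" by (auto simp: l_coset_def)
    have c: "x \<in> carrier G" "y \<in> carrier G" "h \<in> carrier G" "h' \<in> carrier G" "h'' \<in> carrier G"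
      using x y h A B by auto
    have "h \<otimes> (g \<otimes> k) = (h \<otimes> g) \<otimes> k" using c gG kG by (simp add: m_assoc)
    also have "\<dots> = x \<otimes> (h' \<otimes> k)" using c gG kG by (simp add: x(3) m_assoc)
    also have "\<dots> = (x \<otimes> y) \<otimes> h''" using c gG kG by (simp add: y(3) m_assoc)
    finally have "h \<otimes> (g \<otimes> k) \<in> (x \<otimes> y) <#\<^bsub>G\<^esub> H" using y(2) by (auto simp: l_coset_def)
    thus ?thesis using x(1) y(1) by blast
  qed
  hence "H #> (g \<otimes> k) \<subseteq> (\<Union>z\<in>?C. z <#\<^bsub>G\<^esub> H)" by (auto simp: r_coset_def)
  moreover have "finite ?C" "?C \<subseteq> carrier G" using A B by auto
  ultimately show ?thesis using gG kG unfolding group_qn1_def by blast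
qed

lemma subgroup_group_qn1_Int_inv:
  assumes H: "subgroup H G"
  shows "subgroup (group_qn1 G H \<inter> m_inv G ` group_qn1 G H) G"
proof -
  let ?\<Gamma> = "group_qn1 G H"
  have mem: "h \<in> ?\<Gamma> \<inter> m_inv G ` ?\<Gamma> \<longleftrightarrow> h \<in> ?\<Gamma> \<and> inv h \<in> ?\<Gamma>" for h
  proof
    assume "h \<in> ?\<Gamma> \<inter> m_inv G ` ?\<Gamma>"
    thus "h \<in> ?\<Gamma> \<and> inv h \<in> ?\<Gamma>" using group_qn1_subset by (auto simp: subset_iff)
  next
    assume *: "h \<in> ?\<Gamma> \<and> inv h \<in> ?\<Gamma>"
    hence "h = inv (inv h)" using group_qn1_subset by (auto simp: subset_iff)
    thus "h \<in> ?\<Gamma> \<inter> m_inv G ` ?\<Gamma>" using * by blast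
  qed
  have sub: "h \<in> ?\<Gamma> \<Longrightarrow> h \<in> carrier G" for h using group_qn1_subset by auto
  show ?thesis
  proof (rule subgroup.intro)
    show "?\<Gamma> \<inter> m_inv G ` ?\<Gamma> \<subseteq> carrier G" using sub by auto
    show "\<one> \<in> ?\<Gamma> \<inter> m_inv G ` ?\<Gamma>" unfolding mem by (simp add: one_in_group_qn1[OF H])
    show "inv h \<in> ?\<Gamma> \<inter> m_inv G ` ?\<Gamma>" if "h \<in> ?\<Gamma> \<inter> m_inv G ` ?\<Gamma>" for h
      using that sub unfolding mem by auto
    show "g \<otimes> h \<in> ?\<Gamma> \<inter> m_inv G ` ?\<Gamma>"
      if "g \<in> ?\<Gamma> \<inter> m_inv G ` ?\<Gamma>" "h \<in> ?\<Gamma> \<inter> m_inv G ` ?\<Gamma>" for g h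
      using that sub unfolding mem by (auto simp: inv_mult_group intro!: group_qn1_mult[OF H])
  qed
qed

text \<open>
  A convolution operator supported in finitely many disjoint left cosets \<open>tH\<close> is cut into its
  pieces: translate by \<open>t\<^sup>-\<^sup>1\<close>, take the conditional expectation onto \<open>L(H)\<close>, and translate back.
\<close>

lemma sum_right_mult_if_support:
  assumes H: "subgroup H G" and T: "finite T" "T \<subseteq> carrier G" "inj_on (\<lambda>t. t <#\<^bsub>G\<^esub> H) T"
    and y: "y \<in> group_vNa G (carrier G)"
    and supp: "\<And>z. z \<in> carrier G \<Longrightarrow> y (delta \<one>) z \<noteq> 0 \<Longrightarrow> z \<in> (\<Union>t\<in>T. t <#\<^bsub>G\<^esub> H)"
  shows "y \<in> sum_right_mult (left_regular G ` T) (group_vNa G H)"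
proof -
  let ?X = "carrier G" and ?M = "group_vNa G (carrier G)"
  note vN = group_vNa_von_Neumann_algebra[OF subgroup_self]
  define c where "c = (\<lambda>l. cond_exp H (adj ?X l \<circ> y))"
  have lM: "left_regular G t \<in> ?M" if "t \<in> T" for t
    using T that by (intro left_regular_in_group_vNa) auto
  have prod: "adj ?X l \<circ> y \<in> ?M" if "l \<in> left_regular G ` T" for l
    using that lM y by (auto intro!: von_Neumann_algebra_comp[OF vN] von_Neumann_algebra_adj[OF vN])
  have cH: "c l \<in> group_vNa G H" if "l \<in> left_regular G ` T" for l
    unfolding c_def by (rule cond_exp_in_group_vNa[OF H prod[OF that]])
  have yb: "y \<in> bounded_ops ?X" by (rule group_vNa_bounded[OF subgroup_self y])
  have lb: "l \<circ> c l \<in> bounded_ops ?X" if "l \<in> left_regular G ` T" for l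
    using that T group_vNa_bounded[OF H cH[OF that]] by (auto intro!: comp_bounded left_regular_bounded)
  have inj: "inj_on (left_regular G) T" by (rule inj_on_subset[OF left_regular_inj T(2)])
  have "y = (\<lambda>\<xi> v. \<Sum>l\<in>left_regular G ` T. (l \<circ> c l) \<xi> v)"
  proof (rule op_eqI[OF yb])
    show "(\<lambda>\<xi> v. \<Sum>l\<in>left_regular G ` T. (l \<circ> c l) \<xi> v) \<in> bounded_ops ?X"
      by (rule sum_bounded_ops[OF finite_imageI[OF T(1)] lb])
    fix u s assume us: "u \<in> ?X" "s \<in> ?X"
    define z where "z = s \<otimes> inv u"
    have z: "z \<in> ?X" using us by (simp add: z_def)
    have entry: "(left_regular G t \<circ> c (left_regular G t)) (delta u) s
        = (if z \<in> t <#\<^bsub>G\<^esub> H then y (delta \<one>) z else 0)" if t: "t \<in> T" for t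
    proof -
      have tG: "t \<in> ?X" using t T by auto
      have cb: "c (left_regular G t) (delta u) \<in> ell2 ?X"
        using us by (intro op_ell2[OF group_vNa_bounded[OF H cH]] imageI t) simp
      have assoc: "inv t \<otimes> s \<otimes> inv u = inv t \<otimes> z" using tG us by (simp add: z_def m_assoc)
      have mem: "inv t \<otimes> z \<in> H \<longleftrightarrow> z \<in> t <#\<^bsub>G\<^esub> H"
      proof
        assume "inv t \<otimes> z \<in> H"
        moreover have "z = t \<otimes> (inv t \<otimes> z)" using tG z by (simp add: m_assoc[symmetric])
        ultimately show "z \<in> t <#\<^bsub>G\<^esub> H" unfolding l_coset_def by blast
      next
        assume "z \<in> t <#\<^bsub>G\<^esub> H"
        then obtain k where "k \<in> H" "z = t \<otimes> k" by (auto simp: l_coset_def)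
        thus "inv t \<otimes> z \<in> H" using tG subgroup.mem_carrier[OF H] by (simp add: m_assoc[symmetric])
      qed
      have "(left_regular G t \<circ> c (left_regular G t)) (delta u) s
          = c (left_regular G t) (delta u) (inv t \<otimes> s)"
        using tG us cb by (simp add: left_regular_apply)
      also have "\<dots> = (if inv t \<otimes> z \<in> H
          then (adj ?X (left_regular G t) \<circ> y) (delta \<one>) (inv t \<otimes> z) else 0)"
        using tG us cond_exp_matrix[OF H prod[OF imageI[OF t]] us(1), of "inv t \<otimes> s"]
        by (simp add: c_def assoc)
      also have "(adj ?X (left_regular G t) \<circ> y) (delta \<one>) (inv t \<otimes> z) = y (delta \<one>) z"
        using tG z by (simp add: adj_left_regular left_regular_apply op_ell2[OF yb] m_assoc[symmetric])
      finally show ?thesis by (simp add: mem)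
    qed
    have "(\<Sum>l\<in>left_regular G ` T. (l \<circ> c l) (delta u) s)
        = (\<Sum>t\<in>T. if z \<in> t <#\<^bsub>G\<^esub> H then y (delta \<one>) z else 0)"
      using entry by (simp add: sum.reindex[OF inj] cong: sum.cong)
    also have "\<dots> = y (delta \<one>) z"
    proof (cases "y (delta \<one>) z = 0")
      case False
      then obtain t\<^sub>0 where t0: "t\<^sub>0 \<in> T" "z \<in> t\<^sub>0 <#\<^bsub>G\<^esub> H" using supp[OF z] by blast
      have "z \<in> t <#\<^bsub>G\<^esub> H \<longleftrightarrow> t = t\<^sub>0" if t: "t \<in> T" for t
      proof
        assume "z \<in> t <#\<^bsub>G\<^esub> H"
        hence "t <#\<^bsub>G\<^esub> H = t\<^sub>0 <#\<^bsub>G\<^esub> H"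
          using l_repr_independence[OF _ _ H] t t0 T by (metis subsetD)
        thus "t = t\<^sub>0" using T(3) t t0 by (auto dest: inj_onD)
      qed (use t0 in simp)
      thus ?thesis using t0 T by (simp cong: sum.cong)
    qed (simp add: sum.neutral)
    also have "\<dots> = y (delta u) s" by (simp add: z_def group_vNa_matrix[OF y us])
    finally show "y (delta u) s = (\<Sum>l\<in>left_regular G ` T. (l \<circ> c l) (delta u) s)" by simp
  qed
  thus ?thesis using cH by (auto simp: sum_right_mult_def)
qed

text \<open>
  If \<open>Hg\<close> is covered by finitely many left cosets, then for every \<open>b\<close> in \<open>L(H)\<close> the operator
  \<open>b \<lambda>(g)\<close> is supported in this union, and the same representatives serve for all \<open>b\<close>.
\<close>

lemma left_regular_finite_sum:
  assumes H: "subgroup H G" and g: "g \<in> group_qn1 G H"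
  obtains T where "finite T" "T \<subseteq> carrier G"
    "(\<lambda>b. b \<circ> left_regular G g) ` group_vNa G H \<subseteq> sum_right_mult (left_regular G ` T) (group_vNa G H)"
proof -
  let ?X = "carrier G" and ?M = "group_vNa G (carrier G)"
  note vN = group_vNa_von_Neumann_algebra[OF subgroup_self]
  obtain A where A: "finite A" "A \<subseteq> ?X" "H #> g \<subseteq> (\<Union>x\<in>A. x <#\<^bsub>G\<^esub> H)" and gG: "g \<in> ?X"
    using g by (auto simp: group_qn1_def)
  have "(\<lambda>x. x <#\<^bsub>G\<^esub> H) ` A \<subseteq> (\<lambda>x. x <#\<^bsub>G\<^esub> H) ` A" ..
  then obtain T where T: "T \<subseteq> A" "inj_on (\<lambda>x. x <#\<^bsub>G\<^esub> H) T" "(\<lambda>x. x <#\<^bsub>G\<^esub> H) ` A = (\<lambda>x. x <#\<^bsub>G\<^esub> H) ` T"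
    unfolding subset_image_inj by blast
  have TG: "finite T" "T \<subseteq> ?X" using T A finite_subset by auto
  have "b \<circ> left_regular G g \<in> sum_right_mult (left_regular G ` T) (group_vNa G H)"
    if b: "b \<in> group_vNa G H" for b
  proof (rule sum_right_mult_if_support[OF H TG T(2)])
    have bM: "b \<in> ?M" using b group_vNa_subset_carrier[OF H] by auto
    show "b \<circ> left_regular G g \<in> ?M"
      by (intro von_Neumann_algebra_comp[OF vN bM] left_regular_in_group_vNa gG)
    fix z assume z: "z \<in> ?X" "(b \<circ> left_regular G g) (delta \<one>) z \<noteq> 0"
    hence "b (delta \<one>) (z \<otimes> inv g) \<noteq> 0"
      using gG by (simp add: left_regular_delta group_vNa_matrix[OF bM gG z(1)])
    hence "z \<otimes> inv g \<in> H" using group_vNa_support[OF H b] by blast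
    moreover have "z = (z \<otimes> inv g) \<otimes> g" using z gG by (simp add: m_assoc)
    ultimately have "z \<in> H #> g" unfolding r_coset_def by blast
    hence "z \<in> \<Union> ((\<lambda>x. x <#\<^bsub>G\<^esub> H) ` A)" using A(3) by blast
    thus "z \<in> (\<Union>t\<in>T. t <#\<^bsub>G\<^esub> H)" unfolding T(3) .
  qed
  thus thesis using TG by (intro that) auto
qed

end

section \<open>Adjoints of finite sums\<close>

lemma adj_image_reindex:
  assumes "F \<subseteq> bounded_ops X"
  shows "(\<Sum>z\<in>adj X ` F. \<psi> z) = (\<Sum>y\<in>F. \<psi> (adj X y))"
proof -
  have "inj_on (adj X) F" by (rule inj_on_inverseI[where g = "adj X"]) (use assms adj_adj in blast)
  thus ?thesis by (simp add: sum.reindex)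
qed

lemma sum_left_mult_adj:
  assumes F: "finite F" "F \<subseteq> bounded_ops X" and B: "B \<subseteq> bounded_ops X" "\<And>b. b \<in> B \<Longrightarrow> adj X b \<in> B"
    and x: "x \<in> bounded_ops X" and incl: "(\<lambda>b. b \<circ> x) ` B \<subseteq> sum_right_mult F B"
  shows "(\<lambda>b. adj X x \<circ> b) ` B \<subseteq> sum_left_mult B (adj X ` F)"
proof (rule image_subsetI)
  fix b assume b: "b \<in> B"
  have bb: "b \<in> bounded_ops X" using b B by auto
  have "adj X b \<circ> x \<in> sum_right_mult F B" using incl B(2)[OF b] by (rule image_subset_iff[THEN iffD1, rule_format])
  then obtain c where c: "\<And>y. y \<in> F \<Longrightarrow> c y \<in> B"
    and eq: "adj X b \<circ> x = (\<lambda>\<xi> v. \<Sum>y\<in>F. (y \<circ> c y) \<xi> v)"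
    unfolding sum_right_mult_def by blast
  have yb: "y \<in> bounded_ops X" "c y \<in> bounded_ops X" if "y \<in> F" for y
    using that F B c by auto
  have "adj X x \<circ> b = adj X (adj X b \<circ> x)"
    by (simp add: adj_comp adj_bounded bb x adj_adj)
  also have "\<dots> = (\<lambda>\<xi> v. \<Sum>y\<in>F. adj X (y \<circ> c y) \<xi> v)"
    unfolding eq by (rule adj_sum[OF F(1)]) (rule comp_bounded; simp add: yb)
  also have "\<dots> = (\<lambda>\<xi> v. \<Sum>y\<in>F. (adj X (c y) \<circ> adj X y) \<xi> v)"
    by (simp add: yb adj_comp cong: sum.cong)
  also have "\<dots> = (\<lambda>\<xi> v. \<Sum>z\<in>adj X ` F. (adj X (c (adj X z)) \<circ> z) \<xi> v)"
    by (simp add: adj_image_reindex[OF F(2)] yb adj_adj cong: sum.cong)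
  finally show "adj X x \<circ> b \<in> sum_left_mult B (adj X ` F)"
    unfolding sum_left_mult_def using c B(2) yb
    by (auto simp: adj_adj intro!: exI[of _ "\<lambda>z. adj X (c (adj X z))"])
qed

lemma sum_right_mult_adj:
  assumes F: "finite F" "F \<subseteq> bounded_ops X" and B: "B \<subseteq> bounded_ops X" "\<And>b. b \<in> B \<Longrightarrow> adj X b \<in> B"
    and x: "x \<in> bounded_ops X" and incl: "(\<lambda>b. x \<circ> b) ` B \<subseteq> sum_left_mult B F"
  shows "(\<lambda>b. b \<circ> adj X x) ` B \<subseteq> sum_right_mult (adj X ` F) B"
proof (rule image_subsetI)
  fix b assume b: "b \<in> B"
  have bb: "b \<in> bounded_ops X" using b B by auto
  have "x \<circ> adj X b \<in> sum_left_mult B F" using incl B(2)[OF b] by (rule image_subset_iff[THEN iffD1, rule_format])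
  then obtain c where c: "\<And>y. y \<in> F \<Longrightarrow> c y \<in> B"
    and eq: "x \<circ> adj X b = (\<lambda>\<xi> v. \<Sum>y\<in>F. (c y \<circ> y) \<xi> v)"
    unfolding sum_left_mult_def by blast
  have yb: "y \<in> bounded_ops X" "c y \<in> bounded_ops X" if "y \<in> F" for y
    using that F B c by auto
  have "b \<circ> adj X x = adj X (x \<circ> adj X b)"
    by (simp add: adj_comp adj_bounded bb x adj_adj)
  also have "\<dots> = (\<lambda>\<xi> v. \<Sum>y\<in>F. adj X (c y \<circ> y) \<xi> v)"
    unfolding eq by (rule adj_sum[OF F(1)]) (rule comp_bounded; simp add: yb)
  also have "\<dots> = (\<lambda>\<xi> v. \<Sum>y\<in>F. (adj X y \<circ> adj X (c y)) \<xi> v)"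
    by (simp add: yb adj_comp cong: sum.cong)
  also have "\<dots> = (\<lambda>\<xi> v. \<Sum>z\<in>adj X ` F. (z \<circ> adj X (c (adj X z))) \<xi> v)"
    by (simp add: adj_image_reindex[OF F(2)] yb adj_adj cong: sum.cong)
  finally show "b \<circ> adj X x \<in> sum_right_mult (adj X ` F) B"
    unfolding sum_right_mult_def using c B(2) yb
    by (auto simp: adj_adj intro!: exI[of _ "\<lambda>z. adj X (c (adj X z))"])
qed

lemma sum_right_mult_mono:
  assumes "finite F'" "F \<subseteq> F'" "F' \<subseteq> bounded_ops X" "(\<lambda>_ _. 0) \<in> B"
  shows "sum_right_mult F B \<subseteq> sum_right_mult F' B"
proof
  fix x assume "x \<in> sum_right_mult F B"
  then obtain c where c: "\<forall>y\<in>F. c y \<in> B" "x = (\<lambda>\<xi> v. \<Sum>y\<in>F. (y \<circ> c y) \<xi> v)"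
    by (auto simp: sum_right_mult_def)
  define c' where "c' = (\<lambda>y. if y \<in> F then c y else (\<lambda>_ _. 0))"
  have "y (c' y \<xi>) v = 0" if "y \<in> F' - F" for y \<xi> v
    using that assms(3) by (auto simp: c'_def op_zero)
  hence "x = (\<lambda>\<xi> v. \<Sum>y\<in>F'. (y \<circ> c' y) \<xi> v)"
    unfolding c(2) using assms by (intro ext sum.mono_neutral_cong_left) (auto simp: c'_def)
  thus "x \<in> sum_right_mult F' B"
    using c(1) assms(4) by (auto simp: sum_right_mult_def c'_def intro!: exI[of _ c'])
qed

lemma sum_left_mult_mono:
  assumes "finite F'" "F \<subseteq> F'" "(\<lambda>_ _. 0) \<in> B"
  shows "sum_left_mult B F \<subseteq> sum_left_mult B F'"
proof
  fix x assume "x \<in> sum_left_mult B F"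
  then obtain c where c: "\<forall>y\<in>F. c y \<in> B" "x = (\<lambda>\<xi> v. \<Sum>y\<in>F. (c y \<circ> y) \<xi> v)"
    by (auto simp: sum_left_mult_def)
  define c' where "c' = (\<lambda>y. if y \<in> F then c y else (\<lambda>_ _. 0))"
  have "x = (\<lambda>\<xi> v. \<Sum>y\<in>F'. (c' y \<circ> y) \<xi> v)"
    unfolding c(2) using assms by (intro ext sum.mono_neutral_cong_left) (auto simp: c'_def)
  thus "x \<in> sum_left_mult B F'"
    using c(1) assms(3) by (auto simp: sum_left_mult_def c'_def intro!: exI[of _ c'])
qed

section \<open>The generated von Neumann algebras\<close>

lemma vN_generated_eqI:
  assumes "von_Neumann_algebra X N" "S \<subseteq> N"
    and "\<And>M. von_Neumann_algebra X M \<Longrightarrow> S \<subseteq> M \<Longrightarrow> N \<subseteq> M"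
  shows "vN_generated X S = N"
  using assms by (auto simp: vN_generated_def)

context group
begin

lemma left_regular_in_vN_qn1:
  assumes H: "subgroup H G" and g: "g \<in> group_qn1 G H"
  shows "left_regular G g \<in> vN_qn1 (group_vNa G (carrier G)) (group_vNa G H)"
proof -
  obtain T where T: "finite T" "T \<subseteq> carrier G"
    "(\<lambda>b. b \<circ> left_regular G g) ` group_vNa G H \<subseteq> sum_right_mult (left_regular G ` T) (group_vNa G H)"
    using left_regular_finite_sum[OF H g] by blast
  show ?thesis
    unfolding vN_qn1_def
    using T g group_qn1_subset[of H]
    by (intro CollectI conjI exI[of _ "left_regular G ` T"]) (auto intro!: left_regular_in_group_vNa)
qed

lemma left_regular_in_vN_qn:
  assumes H: "subgroup H G" and g: "g \<in> group_qn1 G H" "inv g \<in> group_qn1 G H"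
  shows "left_regular G g \<in> vN_qn (group_vNa G (carrier G)) (group_vNa G H)"
proof -
  let ?X = "carrier G" and ?M = "group_vNa G (carrier G)" and ?B = "group_vNa G H"
  have gG: "g \<in> ?X" using g group_qn1_subset by auto
  note vM = group_vNa_von_Neumann_algebra[OF subgroup_self]
  note vB = group_vNa_von_Neumann_algebra[OF H]
  obtain T where T: "finite T" "T \<subseteq> ?X"
    "(\<lambda>b. b \<circ> left_regular G g) ` ?B \<subseteq> sum_right_mult (left_regular G ` T) ?B"
    using left_regular_finite_sum[OF H g(1)] by blast
  obtain U where U: "finite U" "U \<subseteq> ?X"
    "(\<lambda>b. b \<circ> left_regular G (inv g)) ` ?B \<subseteq> sum_right_mult (left_regular G ` U) ?B"
    using left_regular_finite_sum[OF H g(2)] by blast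
  have U': "(\<lambda>b. left_regular G g \<circ> b) ` ?B \<subseteq> sum_left_mult ?B (adj ?X ` left_regular G ` U)"
    using sum_left_mult_adj[OF _ left_regular_image_bounded[OF U(2)] _ _ left_regular_bounded U(3)]
      U(1) gG group_vNa_bounded[OF H] von_Neumann_algebra_adj[OF vB]
    by (auto simp: adj_left_regular)
  define F where "F = left_regular G ` T \<union> adj ?X ` left_regular G ` U"
  have FM: "F \<subseteq> ?M"
    using T(2) U(2) unfolding F_def
    by (auto intro!: left_regular_in_group_vNa von_Neumann_algebra_adj[OF vM])
  have Fb: "F \<subseteq> bounded_ops ?X" using FM group_vNa_bounded[OF subgroup_self] by blast
  have fin: "finite F" using T U by (simp add: F_def)
  have "(\<lambda>b. b \<circ> left_regular G g) ` ?B \<subseteq> sum_right_mult F ?B"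
    by (rule order_trans[OF T(3) sum_right_mult_mono[OF fin _ Fb zero_in_group_vNa[OF H]]])
      (simp add: F_def)
  moreover have "(\<lambda>b. left_regular G g \<circ> b) ` ?B \<subseteq> sum_left_mult ?B F"
    by (rule order_trans[OF U' sum_left_mult_mono[OF fin _ zero_in_group_vNa[OF H]]])
      (simp add: F_def)
  ultimately show ?thesis
    unfolding vN_qn_def using fin FM left_regular_in_group_vNa[OF gG] by blast
qed

text \<open>
  The second inclusion for \<open>x\<close> is the first inclusion for \<open>x\<^sup>*\<close>.  As the function of \<open>x\<^sup>*\<close> at
  \<open>z\<^sup>-\<^sup>1\<close> is conjugate to that of \<open>x\<close> at \<open>z\<close>, this puts the support of \<open>x\<close> into
  \<open>\<Gamma>\<^sup>-\<^sup>1\<close> as well.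
\<close>

lemma vN_qn_adj_in_vN_qn1:
  assumes H: "subgroup H G" and x: "x \<in> vN_qn (group_vNa G (carrier G)) (group_vNa G H)"
  shows "adj (carrier G) x \<in> vN_qn1 (group_vNa G (carrier G)) (group_vNa G H)"
proof -
  let ?X = "carrier G" and ?M = "group_vNa G (carrier G)" and ?B = "group_vNa G H"
  note vM = group_vNa_von_Neumann_algebra[OF subgroup_self]
  note vB = group_vNa_von_Neumann_algebra[OF H]
  obtain F where xM: "x \<in> ?M" and F: "finite F" "F \<subseteq> ?M"
    and xF: "(\<lambda>b. x \<circ> b) ` ?B \<subseteq> sum_left_mult ?B F"
    using x by (auto simp: vN_qn_def)
  have Fb: "F \<subseteq> bounded_ops ?X" using F group_vNa_bounded[OF subgroup_self] by blast
  have "(\<lambda>b. b \<circ> adj ?X x) ` ?B \<subseteq> sum_right_mult (adj ?X ` F) ?B"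
    using sum_right_mult_adj[OF F(1) Fb _ _ group_vNa_bounded[OF subgroup_self xM] xF]
      group_vNa_bounded[OF H] von_Neumann_algebra_adj[OF vB] by blast
  moreover have "adj ?X x \<in> ?M" by (rule von_Neumann_algebra_adj[OF vM xM])
  moreover have "adj ?X ` F \<subseteq> ?M" using F von_Neumann_algebra_adj[OF vM] by blast
  ultimately show ?thesis unfolding vN_qn1_def using F(1) by blast
qed

lemma vN_generated_vN_qn:
  assumes H: "subgroup H G"
  shows "vN_generated (carrier G) (vN_qn (group_vNa G (carrier G)) (group_vNa G H))
    = group_vNa G (group_qn1 G H \<inter> m_inv G ` group_qn1 G H)"
proof (rule vN_generated_eqI)
  let ?X = "carrier G" and ?M = "group_vNa G (carrier G)" and ?B = "group_vNa G H"
  let ?\<Gamma> = "group_qn1 G H"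
  let ?H1 = "?\<Gamma> \<inter> m_inv G ` ?\<Gamma>"
  note H1 = subgroup_group_qn1_Int_inv[OF H]
  show "von_Neumann_algebra ?X (group_vNa G ?H1)" by (rule group_vNa_von_Neumann_algebra[OF H1])
  show "vN_qn ?M ?B \<subseteq> group_vNa G ?H1"
  proof
    fix x assume x: "x \<in> vN_qn ?M ?B"
    have xM: "x \<in> ?M" using x by (simp add: vN_qn_def)
    have xb: "x \<in> bounded_ops ?X" by (rule group_vNa_bounded[OF subgroup_self xM])
    have x1: "x \<in> vN_qn1 ?M ?B" using x by (auto simp: vN_qn_def vN_qn1_def)
    show "x \<in> group_vNa G ?H1"
    proof (rule group_vNa_if_support[OF H1 xM], rule ccontr)
      fix z assume z: "z \<in> ?X" "z \<notin> ?H1" "x (delta \<one>) z \<noteq> 0"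
      have "adj ?X x (delta \<one>) (inv z) = cnj (x (delta \<one>) z)"
        using z by (simp add: adj_matrix[OF xb] group_vNa_matrix[OF xM, of "inv z"])
      hence "adj ?X x (delta \<one>) (inv z) \<noteq> 0" using z by simp
      hence "inv z \<in> ?\<Gamma>"
        using z by (intro vN_qn1_support[OF H vN_qn_adj_in_vN_qn1[OF H x]]) auto
      moreover have "z \<in> ?\<Gamma>" by (rule vN_qn1_support[OF H x1 z(1,3)])
      moreover have "z = inv (inv z)" using z by simp
      ultimately show False using z(2) by blast
    qed
  qed
  fix M assume M: "von_Neumann_algebra ?X M" "vN_qn ?M ?B \<subseteq> M"
  have "left_regular G ` ?H1 \<subseteq> vN_qn ?M ?B"
    using group_qn1_subset[of H]
    by (auto intro!: left_regular_in_vN_qn[OF H] simp: subset_iff)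
  hence "left_regular G ` ?H1 \<subseteq> M" using M(2) by blast
  thus "group_vNa G ?H1 \<subseteq> M"
    unfolding group_vNa_def[of G ?H1] by (rule vN_generated_least[OF M(1)])
qed

lemma vN_generated_vN_qn1:
  assumes H: "subgroup H G"
  shows "vN_generated (carrier G) (vN_qn1 (group_vNa G (carrier G)) (group_vNa G H))
    = group_vNa G (generate G (group_qn1 G H))"
proof (rule vN_generated_eqI)
  let ?X = "carrier G" and ?M = "group_vNa G (carrier G)" and ?B = "group_vNa G H"
  let ?\<Gamma> = "group_qn1 G H"
  note H2 = generate_is_subgroup[OF group_qn1_subset[of H]]
  show "von_Neumann_algebra ?X (group_vNa G (generate G ?\<Gamma>))"
    by (rule group_vNa_von_Neumann_algebra[OF H2])
  show "vN_qn1 ?M ?B \<subseteq> group_vNa G (generate G ?\<Gamma>)"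
  proof
    fix x assume x: "x \<in> vN_qn1 ?M ?B"
    show "x \<in> group_vNa G (generate G ?\<Gamma>)"
    proof (rule group_vNa_if_support[OF H2])
      show "x \<in> ?M" using x by (simp add: vN_qn1_def)
      show "x (delta \<one>) z = 0" if "z \<in> ?X" "z \<notin> generate G ?\<Gamma>" for z
        using vN_qn1_support[OF H x that(1)] generate.incl[of z ?\<Gamma> G] that(2) by blast
    qed
  qed
  fix M assume M: "von_Neumann_algebra ?X M" "vN_qn1 ?M ?B \<subseteq> M"
  have \<Gamma>M: "left_regular G g \<in> M" if "g \<in> ?\<Gamma>" for g
    using left_regular_in_vN_qn1[OF H that] M(2) by blast
  have "left_regular G g \<in> M" if "g \<in> generate G ?\<Gamma>" for g
    using that
  proof induction
    case one
    show ?case by (rule \<Gamma>M[OF one_in_group_qn1[OF H]])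
  next
    case (incl h)
    thus ?case by (rule \<Gamma>M)
  next
    case (inv h)
    thus ?case
      using von_Neumann_algebra_adj[OF M(1) \<Gamma>M[OF inv]] group_qn1_subset[of H]
      by (auto simp: adj_left_regular subset_iff)
  next
    case (eng h k)
    hence "h \<in> ?X" "k \<in> ?X" using subgroup.subset[OF H2] by auto
    thus ?case using von_Neumann_algebra_comp[OF M(1) eng.IH] by (simp add: left_regular_comp)
  qed
  hence "left_regular G ` generate G ?\<Gamma> \<subseteq> M" by blast
  thus "group_vNa G (generate G ?\<Gamma>) \<subseteq> M"
    unfolding group_vNa_def[of G "generate G ?\<Gamma>"] by (rule vN_generated_least[OF M(1)])
qed

end

theorem corollary5p2:
  fixes G :: "('a, 'b) monoid_scheme" and H \<Gamma> H\<^sub>1 H\<^sub>2 :: "'a set"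
  assumes "group G" and "subgroup H G"
    and "\<Gamma> = group_qn1 G H"
    and "H\<^sub>1 = \<Gamma> \<inter> m_inv G ` \<Gamma>"
    and "H\<^sub>2 = generate G \<Gamma>"
  shows "vN_generated (carrier G) (vN_qn (group_vNa G (carrier G)) (group_vNa G H))
           = group_vNa G H\<^sub>1
       \<and> vN_generated (carrier G) (vN_qn1 (group_vNa G (carrier G)) (group_vNa G H))
           = group_vNa G H\<^sub>2"
  unfolding assms(3-5)
  using group.vN_generated_vN_qn[OF assms(1,2)] group.vN_generated_vN_qn1[OF assms(1,2)] by blast

end
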